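(* Let $m$ be a positive integer. There exists an odd-filterable numerical semigroup of multiplicity $m$ that is simultaneously a discretization of the logarithmic monoid $L$ and a discretization of the golden fractal monoid $F$ if and only if $m\in\{1,2,3,4,5,6,7,8,10,12\}$. Explicitly: there exist real numbers $\alpha_L,\alpha_F\in[0,1]$ such that $S:=\lfloor mL\rfloor_{\alpha_L}=\lfloor mF\rfloor_{\alpha_F}$ is a numerical semigroup and $S$ is odd-filterable both with respect to $L,m,\alpha_L$ and with respect to $F,m,\alpha_F$, if and only if $m\in\{1,2,3,4,5,6,7,8,10,12\}$.
   Context: $\mathbb{N}=\{1,2,3,\dots\}$ and $\mathbb{N}_0=\mathbb{N}\cup\{0\}$. A numerical semigroup is an additive submonoid of $\mathbb{N}_0$ (containing $0$) with finite complement in $\mathbb{N}_0$; its multiplicity is its smallest non-zero element. For $r\in\mathbb{R}$ and $\alpha\in[0,1]$, put $\lfloor r\rfloor_\alpha=\lfloor r\rfloor$ if $r-\lfloor r\rfloor<\alpha$, and $\lfloor r\rfloor_\alpha=\lceil r\rceil$ otherwise. For a set $M$ of real numbers and a positive integer $m$, $\lfloor mM\rfloor_\alpha=\{\lfloor mr\rfloor_\alpha: r\in M\}$. A numerical semigroup of multiplicity $m$ is a discretization of $M$ (for $M=L$ or $M=F$ below) if it equals $\lfloor mM\rfloor_\alpha$ for some $\alpha\in[0,1]$. The logarithmic monoid is $L=\{\log_2(i): i\in\mathbb{N}\}$. The golden fractal monoid $F$ is defined as follows. Let $\phi=\frac{1+\sqrt5}{2}$. Put $\pi_1=\{1,\phi\}$.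 Recursively, for $i\ge1$, if $\pi_i=\{i+\tau_0,i+\tau_1,\dots,i+\tau_{2^i-1}\}$ with $0=\tau_0<\tau_1<\dots<\tau_{2^i-1}<1$, and one sets $\tau_{2^i}=1$, then $$\pi_{i+1}=\bigcup_{r=0}^{2^i-1}\left\{(i+1)+\tau_r,\ (i+1)+\tau_r+(\phi-1)(\tau_{r+1}-\tau_r)\right\}.$$ Then $F=\{0\}\cup\bigcup_{i\ge1}\pi_i$. Let $M=\{\mu_1<\mu_2<\mu_3<\cdots\}$ be $L$ or $F$, enumerated in increasing order starting at index $1$, and suppose $S=\lfloor mM\rfloor_\alpha$ is a numerical semigroup. The collapse of $S$ with respect to $M,m,\alpha$ is the smallest integer $\kappa$ such that $\kappa=\lfloor m\mu_i\rfloor_\alpha=\lfloor m\mu_{i+1}\rfloor_\alpha$ for some $i\in\mathbb{N}$. Enumerate $S=\{s_1=0<s_2<s_3<\cdots\}$. $S$ is odd-filterable with respect to $M,m,\alpha$ if the sum of any two (possibly equal) elements of $S$ with odd index is an element of $S$ which either has odd index or is bigger than or equal to the collapse of $S$ with respect to $M,m,\alpha$. *)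

theory Defs
  imports Complex_Main "HOL-Library.Infinite_Set"
begin

definition numerical_semigroup :: "nat set \<Rightarrow> bool" where
  "numerical_semigroup S \<longleftrightarrow>
     0 \<in> S \<and> (\<forall>a\<in>S. \<forall>b\<in>S. a + b \<in> S) \<and> finite (- S)"

definition multiplicity_ns :: "nat set \<Rightarrow> nat" where
  "multiplicity_ns S = (LEAST x. x \<in> S \<and> x \<noteq> 0)"

definition floor_alpha :: "real \<Rightarrow> real \<Rightarrow> int" where
  "floor_alpha \<alpha> r = (if r - of_int \<lfloor>r\<rfloor> < \<alpha> then \<lfloor>r\<rfloor> else \<lceil>r\<rceil>)"

definition floor_alpha_set :: "real \<Rightarrow> nat \<Rightarrow> real set \<Rightarrow> int set" where
  "floor_alpha_set \<alpha> m M = (\<lambda>r. floor_alpha \<alpha> (real m * r)) ` M"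

text \<open>
  The set \<open>S\<close> lives in the natural numbers, whereas rounding yields integers;
  hence the embedding \<open>int\<close>.
\<close>
definition discretization_with :: "real \<Rightarrow> nat \<Rightarrow> real set \<Rightarrow> nat set \<Rightarrow> bool" where
  "discretization_with \<alpha> m M S \<longleftrightarrow>
     0 \<le> \<alpha> \<and> \<alpha> \<le> 1 \<and> numerical_semigroup S \<and> multiplicity_ns S = m \<and>
     int ` S = floor_alpha_set \<alpha> m M"

definition log_monoid :: "real set" where
  "log_monoid = {log 2 (real i) | i::nat. 1 \<le> i}"

definition golden :: real where
  "golden = (1 + sqrt 5) / 2"

text \<open>
  For \<open>P = {i + \<tau>\<^sub>0, i + \<tau>\<^sub>1, \<dots>}\<close>, the numbers \<open>\<tau>\<^sub>r\<close> in increasing order, extended by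
  \<open>\<tau>\<^sub>r = 1\<close> for \<open>r = 2 ^ i\<close>.
\<close>
definition offset :: "nat \<Rightarrow> real set \<Rightarrow> nat \<Rightarrow> real" where
  "offset i P r =
     (if r < 2 ^ i then sorted_list_of_set ((\<lambda>x. x - real i) ` P) ! r else 1)"

text \<open>The periods are indexed from \<open>1\<close>; the value at \<open>0\<close> is a dummy.\<close>
fun golden_period :: "nat \<Rightarrow> real set" where
  "golden_period 0 = {}"
| "golden_period (Suc 0) = {1, golden}"
| "golden_period (Suc (Suc n)) =
     (let i = Suc n; \<tau> = offset i (golden_period i) in
        \<Union>r\<in>{0..2 ^ i - 1}.
          {real (i + 1) + \<tau> r,
           real (i + 1) + \<tau> r + (golden - 1) * (\<tau> (r + 1) - \<tau> r)})"

definition golden_fractal_monoid :: "real set" where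
  "golden_fractal_monoid = {0} \<union> (\<Union>i\<in>{1..}. golden_period i)"

text \<open>The increasing enumeration of \<open>M\<close> with indices starting at \<open>1\<close>.\<close>
definition nth_element :: "real set \<Rightarrow> nat \<Rightarrow> real" where
  "nth_element M i = (THE f :: nat \<Rightarrow> real. strict_mono f \<and> range f = M) (i - 1)"

definition collapse :: "real set \<Rightarrow> nat \<Rightarrow> real \<Rightarrow> int" where
  "collapse M m \<alpha> =
     (LEAST \<kappa>. \<exists>i\<ge>1. \<kappa> = floor_alpha \<alpha> (real m * nth_element M i) \<and>
                   \<kappa> = floor_alpha \<alpha> (real m * nth_element M (i + 1)))"

text \<open>
  \<open>enumerate\<close> counts from \<open>0\<close>, so the element of \<open>S\<close> with index \<open>i \<ge> 1\<close> is
  \<open>enumerate S (i - 1)\<close>.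
\<close>
definition odd_index :: "nat set \<Rightarrow> nat \<Rightarrow> bool" where
  "odd_index S a \<longleftrightarrow> (\<exists>i\<ge>1. odd i \<and> a = enumerate S (i - 1))"

definition odd_filterable :: "nat set \<Rightarrow> real set \<Rightarrow> nat \<Rightarrow> real \<Rightarrow> bool" where
  "odd_filterable S M m \<alpha> \<longleftrightarrow>
     (\<forall>a\<in>S. \<forall>b\<in>S. odd_index S a \<and> odd_index S b \<longrightarrow>
        a + b \<in> S \<and> (odd_index S (a + b) \<or> collapse M m \<alpha> \<le> int (a + b)))"

end

theory Submission imports Defs begin

text \<open>
  Both monoids are the set of values \<open>g n\<close>, \<open>n \<ge> 1\<close>, of a strictly increasing sequence with \<open>g 1 = 0\<close> and
  \<open>g (2 * n) = g n + 1\<close>: the sequence \<open>log 2 n\<close> for the logarithmic monoid, and for the golden fractal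
  monoid a sequence \<open>gold\<close> that divides the gap between \<open>gold (2 * n)\<close> and \<open>gold (2 * n + 2)\<close> in the golden
  ratio (\<open>golden_fractal_monoid_eq\<close>). The rounded sequence of the numbers \<open>m * g n\<close> is then monotone
  and rises by \<open>m\<close> when the index is doubled. So if consecutive values differ by at most one for indices
  between \<open>K\<close> and \<open>2 * K\<close>, they do so for all larger indices (\<open>steps_propagate\<close>), and finitely many values
  determine the discretization and its properties (\<open>discretization_from_table\<close>).

  For the ten multiplicities, suitable thresholds are given explicitly. The required rounding
  decisions are integer inequalities: for the logarithms they compare powers of integers, and the values of
  \<open>gold\<close> have the form \<open>a + b * \<phi>\<close> with integers \<open>a\<close> and \<open>b\<close>, for the golden ratio \<open>\<phi>\<close>.

  Conversely, let \<open>m \<ge> 9\<close> and let \<open>S\<close> be a discretization of both monoids. The first eleven elements of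
  either monoid are so far apart that their rounded values are pairwise distinct; hence
  \<open>m * log 2 n\<close> and \<open>m * gold n\<close> are rounded to the same integer for \<open>n \<le> 11\<close> (\<open>agree\<close>). As \<open>gold 11\<close> exceeds
  \<open>log 2 11\<close> by more than \<open>2 / 30\<close>, this bounds \<open>m\<close> below 30, and for most of the smaller multiplicities the
  two numbers are still separated by an interval between consecutive integers for some \<open>n\<close>. In the few
  cases left, agreement restricts the thresholds so much that the two discretizations visibly differ, or
  that the sum of two elements of small odd index is either missing from \<open>S\<close> or an element of even
  index below the collapse.
\<close>

section \<open>Rounding\<close>

lemma floor_alpha_ge_floor: "\<lfloor>x\<rfloor> \<le> floor_alpha \<alpha> x"
  by (simp add: floor_alpha_def floor_le_ceiling)

lemma floor_alpha_le_ceiling: "floor_alpha \<alpha> x \<le> \<lceil>x\<rceil>"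
  by (simp add: floor_alpha_def floor_le_ceiling)

lemma floor_alpha_mono:
  assumes "x \<le> y"
  shows "floor_alpha \<alpha> x \<le> floor_alpha \<alpha> y"
proof (cases "\<lfloor>x\<rfloor> = \<lfloor>y\<rfloor>")
  case True
  then have "x - of_int \<lfloor>x\<rfloor> \<le> y - of_int \<lfloor>y\<rfloor>"
    using assms by simp
  then show ?thesis
    using True assms ceiling_mono[OF assms]
    by (auto simp: floor_alpha_def floor_le_ceiling)
next
  case False
  then have "\<lceil>x\<rceil> \<le> \<lfloor>y\<rfloor>"
    using floor_mono[OF assms] by linarith
  then show ?thesis
    using floor_alpha_le_ceiling[of \<alpha> x] floor_alpha_ge_floor[of y \<alpha>] by linarith
qed

lemma floor_alpha_add_int: "floor_alpha \<alpha> (x + of_int k) = floor_alpha \<alpha> x + k"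
  by (simp add: floor_alpha_def)

lemma floor_alpha_zero: "floor_alpha \<alpha> 0 = 0"
  by (simp add: floor_alpha_def)

lemma floor_alpha_less_if_gap_one:
  assumes "x + 1 \<le> y"
  shows "floor_alpha \<alpha> x < floor_alpha \<alpha> y"
  using floor_alpha_mono[OF assms, of \<alpha>] floor_alpha_add_int[of \<alpha> x 1] by simp

lemma floor_alpha_less_if_gap_two:
  assumes "x + 2 \<le> y"
  shows "floor_alpha \<alpha> x < floor_alpha \<beta> y"
  using floor_alpha_le_ceiling[of \<alpha> x] floor_alpha_ge_floor[of y \<beta>] assms
  by linarith

lemma floor_alpha_eq_if_above:
  assumes "of_int k \<le> x" "x < of_int k + \<alpha>" "\<alpha> \<le> 1"
  shows "floor_alpha \<alpha> x = k"
proof -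
  have "\<lfloor>x\<rfloor> = k" using assms by linarith
  then show ?thesis using assms by (simp add: floor_alpha_def)
qed

lemma floor_alpha_eq_if_below:
  assumes "of_int k - 1 + \<alpha> \<le> x" "of_int k - 1 < x" "x \<le> of_int k"
  shows "floor_alpha \<alpha> x = k"
proof (cases "x = of_int k")
  case True
  then show ?thesis by (simp add: floor_alpha_def)
next
  case False
  then have "\<lfloor>x\<rfloor> = k - 1" "\<lceil>x\<rceil> = k" using assms by linarith+
  then show ?thesis using assms by (simp add: floor_alpha_def)
qed

lemma floor_alpha_eq:
  assumes "0 < \<alpha>" "\<alpha> \<le> 1" "of_int k - 1 + \<alpha> \<le> x" "x < of_int k + \<alpha>"
  shows "floor_alpha \<alpha> x = k"
  using assms floor_alpha_eq_if_above[of k x \<alpha>] floor_alpha_eq_if_below[of k \<alpha> x]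
  by linarith

text \<open>
  The direction in which a non-integer is rounded bounds \<open>\<alpha>\<close> by its fractional part. These two
  rules turn observed values of a discretization into information on \<open>\<alpha>\<close>.
\<close>

lemma less_if_rounded_down:
  assumes "floor_alpha \<alpha> x = k" "of_int k < x"
  shows "x < of_int k + \<alpha>"
proof -
  have "k < \<lceil>x\<rceil>" using assms(2) by linarith
  then have "x - of_int \<lfloor>x\<rfloor> < \<alpha> \<and> \<lfloor>x\<rfloor> = k"
    using assms(1) by (auto simp: floor_alpha_def split: if_splits)
  then show ?thesis by auto
qed

lemma ge_if_rounded_up:
  assumes "floor_alpha \<alpha> x = k" "x < of_int k"
  shows "of_int k - 1 + \<alpha> \<le> x"
proof -
  have "\<lfloor>x\<rfloor> < k" using assms(2) by linarith
  then have "\<not> x - of_int \<lfloor>x\<rfloor> < \<alpha> \<and> \<lceil>x\<rceil> = k"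
    using assms(1) by (auto simp: floor_alpha_def split: if_splits)
  moreover have "\<lfloor>x\<rfloor> = k - 1" using calculation assms(2) by linarith
  ultimately show ?thesis by auto
qed

section \<open>Enumerations\<close>

text \<open>
  As long as a monotone enumeration with repetitions has not repeated itself, it agrees with the
  strictly increasing enumeration.
\<close>

lemma enumerate_eq_monotone_sequence:
  fixes b :: "nat \<Rightarrow> nat"
  assumes mono: "\<And>i j. 1 \<le> i \<Longrightarrow> i \<le> j \<Longrightarrow> b i \<le> b j"
    and S: "S = b ` {1..}" and infinite: "infinite S"
    and strict: "\<And>n. 1 \<le> n \<Longrightarrow> n < N \<Longrightarrow> b n < b (Suc n)"
    and N: "i < N"
  shows "enumerate S i = b (Suc i)"
  using N
proof (induction i)
  case 0
  have "(LEAST s. s \<in> S) = b 1"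
    by (rule Least_equality) (auto simp: S intro: mono)
  then show ?case by (simp add: enumerate_0)
next
  case (Suc i)
  then have IH: "enumerate S i = b (Suc i)" by simp
  have "(LEAST s. s \<in> S \<and> s > b (Suc i)) = b (Suc (Suc i))"
  proof (rule Least_equality)
    show "b (Suc (Suc i)) \<in> S \<and> b (Suc i) < b (Suc (Suc i))"
      using strict[of "Suc i"] Suc.prems by (auto simp: S)
    fix s assume s: "s \<in> S \<and> b (Suc i) < s"
    then obtain k where k: "1 \<le> k" "s = b k" by (auto simp: S)
    have "\<not> k \<le> Suc i" using mono[OF k(1), of "Suc i"] s k(2) by auto
    then show "b (Suc (Suc i)) \<le> s" using mono[of "Suc (Suc i)" k] k(2) by auto
  qed
  then show ?case using enumerate_Suc''[OF infinite, of i] IH by simp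
qed

lemma strict_mono_range_unique:
  fixes f h :: "nat \<Rightarrow> 'a::linorder"
  assumes f: "strict_mono f" and h: "strict_mono h" and range: "range f = range h"
  shows "f = h"
proof
  fix n show "f n = h n"
  proof (induction n rule: less_induct)
    case (less n)
    \<comment> \<open>The first value of either sequence not yet used by the other is the next one.\<close>
    have *: "u n \<le> v n" if uv: "strict_mono u" "strict_mono v" "range u = range v"
      "\<And>k. k < n \<Longrightarrow> u k = v k" for u v :: "nat \<Rightarrow> 'a"
    proof -
      have "v n \<in> range u" using uv(3) by simp
      then obtain k where k: "v n = u k" by blast
      have "\<not> k < n" using uv(2,4) k by (metis less_irrefl strict_mono_less)
      then show ?thesis using k uv(1) by (simp add: strict_mono_less_eq)
    qed
    show ?case using *[of f h] *[of h f] f h range less by fastforce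
  qed
qed

text \<open>
  The integers are not well-ordered, so the minimum in the definition of the collapse needs a lower
  bound to be attained.
\<close>

lemma Least_int_nonneg:
  fixes P :: "int \<Rightarrow> bool"
  assumes "P x" and nonneg: "\<And>y. P y \<Longrightarrow> 0 \<le> y"
  shows "P (LEAST y. P y)" "(LEAST y. P y) \<le> x"
proof -
  define n where "n = (LEAST n. P (int n))"
  have ex: "P (int (nat x))" using assms by auto
  have n: "P (int n)" unfolding n_def by (rule LeastI[of "\<lambda>n. P (int n)", OF ex])
  have least: "int n \<le> y" if "P y" for y
    using Least_le[of "\<lambda>n. P (int n)" "nat y"] that nonneg[OF that] by (simp add: n_def)
  have "(LEAST y. P y) = int n"
    by (rule Least_equality) (use n least in auto)
  then show "P (LEAST y. P y)" "(LEAST y. P y) \<le> x" using n least[OF assms(1)] by simp_all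
qed

section \<open>Rounded doubling sequences\<close>

definition rounded :: "(nat \<Rightarrow> real) \<Rightarrow> real \<Rightarrow> nat \<Rightarrow> nat \<Rightarrow> nat" where
  "rounded g \<alpha> m n = nat (floor_alpha \<alpha> (real m * g n))"

fun every_other :: "'a list \<Rightarrow> 'a list" where
  "every_other [] = []"
| "every_other [x] = [x]"
| "every_other (x # y # zs) = x # every_other zs"

lemma in_set_every_other: "x \<in> set (every_other xs) \<longleftrightarrow> (\<exists>j<length xs. even j \<and> x = xs ! j)"
proof (induction xs rule: every_other.induct)
  case (3 y z zs)
  have "(\<exists>j<length (y # z # zs). even j \<and> x = (y # z # zs) ! j) \<longleftrightarrow>
    x = y \<or> (\<exists>j<length zs. even j \<and> x = zs ! j)" (is "?l \<longleftrightarrow> ?r")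
  proof
    assume ?l
    then obtain j where j: "j < length (y # z # zs)" "even j" "x = (y # z # zs) ! j" by blast
    show ?r
    proof (cases j)
      case (Suc i)
      with j obtain k where "j = Suc (Suc k)" by (cases i) auto
      then show ?thesis using j by auto
    qed (use j in simp)
  next
    assume ?r
    then show ?l
    proof
      assume "\<exists>j<length zs. even j \<and> x = zs ! j"
      then obtain j where "j < length zs" "even j" "x = zs ! j" by blast
      then show ?l by (intro exI[of _ "Suc (Suc j)"]) simp
    qed (auto intro: exI[of _ 0])
  qed
  then show ?case using 3 by simp
qed auto

text \<open>
  What the two monoids have in common: both consist of the values, at positive indices, of a strictly
  increasing sequence whose value goes up by one whenever the index is doubled.
\<close>

locale rounded_doubling =
  fixes g :: "nat \<Rightarrow> real" and \<alpha> :: real and m :: nat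
  assumes g_one: "g (Suc 0) = 0"
    and g_less: "\<And>n. 1 \<le> n \<Longrightarrow> g n < g (Suc n)"
    and g_double: "\<And>n. 1 \<le> n \<Longrightarrow> g (2 * n) = g n + 1"
    and alpha: "0 \<le> \<alpha>" "\<alpha> \<le> 1"
    and m_pos: "1 \<le> m"
begin

abbreviation rnd where "rnd \<equiv> rounded g \<alpha> m"

lemma g_mono:
  assumes "1 \<le> i" "i \<le> j"
  shows "g i \<le> g j"
  using assms(2,1)
proof (induction j rule: dec_induct)
  case (step n)
  then show ?case using g_less[of n] by simp
qed simp

lemma nth_element_eq:
  assumes "1 \<le> i"
  shows "nth_element (g ` {1..}) i = g i"
proof -
  define h where "h = (\<lambda>n. g (Suc n))"
  have "strict_mono h" unfolding h_def by (simp add: strict_mono_Suc_iff g_less)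
  moreover have "range h = g ` {1..}"
  proof -
    have "range Suc = {1..}" by (auto simp: image_iff Suc_le_eq gr0_conv_Suc)
    then show ?thesis unfolding h_def by (metis image_image)
  qed
  ultimately have "(THE f. strict_mono f \<and> range f = g ` {1..}) = h"
    by (intro the_equality) (simp_all only: strict_mono_range_unique)
  then show ?thesis using assms by (simp add: nth_element_def h_def)
qed

lemma int_rnd: "1 \<le> n \<Longrightarrow> int (rnd n) = floor_alpha \<alpha> (real m * g n)"
proof -
  assume "1 \<le> n"
  then have "0 \<le> real m * g n" using g_mono[of 1 n] g_one by simp
  then have "0 \<le> floor_alpha \<alpha> (real m * g n)"
    using floor_alpha_mono[of 0 "real m * g n" \<alpha>] floor_alpha_zero by simp
  then show ?thesis by (simp add: rounded_def)
qed

lemma rnd_one: "rnd 1 = 0"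
  using int_rnd[of 1] by (simp add: g_one floor_alpha_zero)

lemma rnd_mono: "1 \<le> i \<Longrightarrow> i \<le> j \<Longrightarrow> rnd i \<le> rnd j"
  unfolding rounded_def
  by (intro nat_mono floor_alpha_mono mult_left_mono g_mono) auto

lemma rnd_double: "1 \<le> n \<Longrightarrow> rnd (2 * n) = rnd n + m"
proof -
  assume n: "1 \<le> n"
  have "real m * g (2 * n) = real m * g n + of_int (int m)"
    using g_double[OF n] by (simp add: algebra_simps)
  then show ?thesis
    using int_rnd[OF n] int_rnd[of "2 * n"] floor_alpha_add_int[of \<alpha> "real m * g n" "int m"] n
    by simp
qed

lemma rnd_two: "rnd 2 = m"
  using rnd_double[of 1] rnd_one by simp

lemma rnd_power: "rnd (2 ^ k * n) = k * m + rnd n" if "1 \<le> n"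
  using that
proof (induction k)
  case (Suc k)
  have "rnd (2 ^ Suc k * n) = rnd (2 * (2 ^ k * n))" by (simp add: mult.assoc)
  also have "\<dots> = rnd (2 ^ k * n) + m" using that by (intro rnd_double) simp
  finally show ?case using Suc by simp
qed simp

lemma rnd_strict:
  assumes "1 \<le> n" "1 \<le> real m * (g (Suc n) - g n)"
  shows "rnd n < rnd (Suc n)"
proof -
  have "real m * g n + 1 \<le> real m * g (Suc n)"
    using assms(2) by (simp add: algebra_simps)
  then have "int (rnd n) < int (rnd (Suc n))"
    using floor_alpha_less_if_gap_one int_rnd[of n] int_rnd[of "Suc n"] assms(1) by simp
  then show ?thesis by simp
qed

lemma discretization_iff:
  "discretization_with \<alpha> m (g ` {1..}) S \<longleftrightarrow> S = rnd ` {1..} \<and> numerical_semigroup S"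
proof -
  have "int ` (rnd ` {1..}) = floor_alpha_set \<alpha> m (g ` {1..})"
    unfolding floor_alpha_set_def image_image
    by (intro image_cong) (simp_all add: int_rnd)
  then have "int ` S = floor_alpha_set \<alpha> m (g ` {1..}) \<longleftrightarrow> S = rnd ` {1..}"
    by (metis inj_image_eq_iff inj_of_nat)
  moreover have "multiplicity_ns (rnd ` {1..}) = m"
    unfolding multiplicity_ns_def
  proof (rule Least_equality)
    show "m \<in> rnd ` {1..} \<and> m \<noteq> 0" using rnd_two m_pos image_eqI[of m rnd 2] by simp
    fix y assume y: "y \<in> rnd ` {1..} \<and> y \<noteq> 0"
    then obtain n where n: "1 \<le> n" "y = rnd n" by auto
    then have "2 \<le> n" using y rnd_one by (cases "n = 1") auto
    then show "m \<le> y" using rnd_mono[of 2 n] rnd_two n by simp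
  qed
  ultimately show ?thesis
    unfolding discretization_with_def using alpha by metis
qed

lemma collapse_eq: "collapse (g ` {1..}) m \<alpha> =
    (LEAST \<kappa>. \<exists>i\<ge>1. \<kappa> = int (rnd i) \<and> \<kappa> = int (rnd (Suc i)))"
proof -
  have val: "floor_alpha \<alpha> (real m * nth_element (g ` {1..}) i) = int (rnd i)" if "1 \<le> i" for i
    using nth_element_eq[OF that] int_rnd[OF that] by simp
  have "(\<exists>i\<ge>1. \<kappa> = floor_alpha \<alpha> (real m * nth_element (g ` {1..}) i) \<and>
      \<kappa> = floor_alpha \<alpha> (real m * nth_element (g ` {1..}) (i + 1))) \<longleftrightarrow>
    (\<exists>i\<ge>1. \<kappa> = int (rnd i) \<and> \<kappa> = int (rnd (Suc i)))" for \<kappa>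
  proof (intro ex_cong1 conj_cong refl)
    fix i :: nat assume "1 \<le> i"
    then show "\<kappa> = floor_alpha \<alpha> (real m * nth_element (g ` {1..}) i) \<longleftrightarrow> \<kappa> = int (rnd i)"
      "\<kappa> = floor_alpha \<alpha> (real m * nth_element (g ` {1..}) (i + 1)) \<longleftrightarrow> \<kappa> = int (rnd (Suc i))"
      using val[of i] val[of "i + 1"] by (simp_all only: Suc_eq_plus1)
  qed
  then show ?thesis unfolding collapse_def by (rule arg_cong[of _ _ Least, OF ext])
qed

lemma collapse_le:
  assumes "1 \<le> i" "rnd i = rnd (Suc i)"
  shows "collapse (g ` {1..}) m \<alpha> \<le> int (rnd i)"
  unfolding collapse_eq
proof (rule Least_int_nonneg(2))
  show "\<exists>j\<ge>1. int (rnd i) = int (rnd j) \<and> int (rnd i) = int (rnd (Suc j))"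
    using assms by (intro exI[of _ i]) simp
qed auto

text \<open>
  Between the indices \<open>2 ^ m\<close> and \<open>2 ^ (m + 1)\<close> the values rise by only \<open>m\<close>, which is less than the
  number \<open>2 ^ m\<close> of steps.
\<close>

lemma ex_repeated: "\<exists>i\<ge>1. rnd i = rnd (Suc i)"
proof (rule ccontr)
  assume "\<not> ?thesis"
  then have lt: "rnd i < rnd (Suc i)" if "1 \<le> i" for i
    using rnd_mono[of i "Suc i"] that by (meson le_neq_implies_less le_Suc_eq order_refl)
  have "rnd (2 ^ m) + j \<le> rnd (2 ^ m + j)" for j
  proof (induction j)
    case (Suc j)
    then show ?case using lt[of "2 ^ m + j"] by (simp add: Suc_le_eq)
  qed simp
  from this[of "2 ^ m"] show False
    using rnd_double[of "2 ^ m"] less_exp[of m] by (simp add: mult_2)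
qed

lemma collapse_ge:
  assumes strict: "\<And>n. 1 \<le> n \<Longrightarrow> n < N \<Longrightarrow> rnd n < rnd (Suc n)" and "1 \<le> N"
  shows "int (rnd N) \<le> collapse (g ` {1..}) m \<alpha>"
proof -
  define P where "P \<kappa> \<longleftrightarrow> (\<exists>i\<ge>1. \<kappa> = int (rnd i) \<and> \<kappa> = int (rnd (Suc i)))" for \<kappa>
  obtain i where "1 \<le> i" "rnd i = rnd (Suc i)" using ex_repeated by blast
  then have "P (int (rnd i))" unfolding P_def by (intro exI[of _ i]) simp
  moreover have "0 \<le> \<kappa>" if "P \<kappa>" for \<kappa> using that unfolding P_def by auto
  ultimately have "P (LEAST \<kappa>. P \<kappa>)" by (rule Least_int_nonneg(1))
  then have "P (collapse (g ` {1..}) m \<alpha>)" unfolding collapse_eq P_def .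
  then obtain j where j: "1 \<le> j" "collapse (g ` {1..}) m \<alpha> = int (rnd j)" "rnd j = rnd (Suc j)"
    unfolding P_def by (metis of_nat_eq_iff)
  then have "N \<le> j" using strict[of j] by linarith
  then show ?thesis using j(2) rnd_mono[of N j] assms(2) by linarith
qed

lemma infinite_range: "infinite (rnd ` {1..})"
proof
  assume "finite (rnd ` {1..})"
  then obtain B where B: "\<And>x. x \<in> rnd ` {1..} \<Longrightarrow> x \<le> B"
    unfolding finite_nat_set_iff_bounded_le by blast
  have "Suc B \<le> Suc B * m"
    using mult_le_mono2[OF m_pos, of "Suc B"] by (simp only: mult_1_right)
  also have "\<dots> = rnd (2 ^ Suc B * 1)" using rnd_power[of 1 "Suc B"] rnd_one by simp
  also have "\<dots> \<le> B" by (rule B) simp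
  finally show False by simp
qed

lemma enumerate_rnd:
  assumes "\<And>n. 1 \<le> n \<Longrightarrow> n < N \<Longrightarrow> rnd n < rnd (Suc n)" "1 \<le> n" "n \<le> N"
  shows "enumerate (rnd ` {1..}) (n - 1) = rnd n"
  using enumerate_eq_monotone_sequence[of rnd, OF rnd_mono refl infinite_range assms(1), where i = "n - 1"] assms(2,3) by simp

text \<open>
  While the rounded sequence is strictly increasing, the index in the semigroup is the index in the
  sequence, and the collapse has not been reached. There odd-filterability is a statement about
  indices of the sequence.
\<close>

lemma odd_sum_has_odd_index:
  assumes filt: "odd_filterable (rnd ` {1..}) (g ` {1..}) m \<alpha>"
    and strict: "\<And>n. 1 \<le> n \<Longrightarrow> n < N \<Longrightarrow> rnd n < rnd (Suc n)"
    and ij: "1 \<le> i" "odd i" "i \<le> N" "1 \<le> j" "odd j" "j \<le> N" "rnd i + rnd j < rnd N"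
  shows "\<exists>k\<le>N. odd k \<and> rnd i + rnd j = rnd k"
proof -
  have idx: "odd_index (rnd ` {1..}) (rnd n)" if "1 \<le> n" "n \<le> N" "odd n" for n
    unfolding odd_index_def using that enumerate_rnd[OF strict that(1,2)] by auto
  have "rnd i \<in> rnd ` {1..}" "rnd j \<in> rnd ` {1..}" using ij by auto
  then have "odd_index (rnd ` {1..}) (rnd i + rnd j) \<or> collapse (g ` {1..}) m \<alpha> \<le> int (rnd i + rnd j)"
    using filt idx[of i] idx[of j] ij unfolding odd_filterable_def by blast
  moreover have "int (rnd N) \<le> collapse (g ` {1..}) m \<alpha>"
    using collapse_ge[OF strict] ij by simp
  ultimately obtain k where k: "1 \<le> k" "odd k" "rnd i + rnd j = enumerate (rnd ` {1..}) (k - 1)"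
    using ij(7) unfolding odd_index_def by force
  have "k \<le> N"
  proof (rule ccontr)
    assume "\<not> k \<le> N"
    then have "enumerate (rnd ` {1..}) (N - 1) \<le> enumerate (rnd ` {1..}) (k - 1)"
      using enumerate_mono_le_iff[OF infinite_range] by simp
    then show False using enumerate_rnd[OF strict, of N] ij k(3) by simp
  qed
  then show ?thesis using k enumerate_rnd[OF strict, of k] by auto
qed

text \<open>
  Doubling maps the steps from \<open>k\<close> to \<open>k + 1\<close> onto the stretches from \<open>2 * k\<close> to \<open>2 * k + 2\<close> and keeps
  the rise; by monotonicity neither half of such a stretch can rise by more than the whole. Hence
  finitely many steps have to be inspected.
\<close>

lemma steps_propagate:
  assumes steps: "\<And>n. K \<le> n \<Longrightarrow> n < 2 * K \<Longrightarrow> rnd (Suc n) \<le> rnd n + 1" and K: "1 \<le> K" and "K \<le> n"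
  shows "rnd (Suc n) \<le> rnd n + 1"
  using \<open>K \<le> n\<close>
proof (induction n rule: less_induct)
  case (less n)
  show ?case
  proof (cases "n < 2 * K")
    case False
    define k where "k = n div 2"
    have k: "K \<le> k" "k < n" "2 * k \<le> n" "Suc n \<le> 2 * Suc k" using False K unfolding k_def by auto
    have "rnd (Suc n) \<le> rnd (2 * Suc k)" using rnd_mono[of "Suc n" "2 * Suc k"] k by simp
    also have "\<dots> = rnd (Suc k) + m" using rnd_double[of "Suc k"] by simp
    also have "\<dots> \<le> rnd k + 1 + m" using less.IH[of k] k by simp
    also have "\<dots> = rnd (2 * k) + 1" using rnd_double[of k] k K by simp
    also have "\<dots> \<le> rnd n + 1" using rnd_mono[of "2 * k" n] k K by simp
    finally show ?thesis .
  qed (use steps less.prems in auto)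
qed

lemma range_eq_prefix_union:
  assumes steps: "\<And>n. K \<le> n \<Longrightarrow> n < 2 * K \<Longrightarrow> rnd (Suc n) \<le> rnd n + 1" and K: "1 \<le> K"
  shows "rnd ` {1..} = rnd ` {1..<K} \<union> {rnd K..}"
proof
  show "rnd ` {1..} \<subseteq> rnd ` {1..<K} \<union> {rnd K..}"
  proof
    fix x assume "x \<in> rnd ` {1..}"
    then obtain n where n: "1 \<le> n" "x = rnd n" by auto
    then show "x \<in> rnd ` {1..<K} \<union> {rnd K..}" using rnd_mono[of K n] K by (cases "n < K") auto
  qed
  have "\<exists>n\<ge>K. rnd n = rnd K + j" for j
  proof (induction j)
    case (Suc j)
    then obtain n where n: "K \<le> n" "rnd n = rnd K + j" by blast
    \<comment> \<open>The last index with this value; the step after it must be a step by one.\<close>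
    obtain B where B: "1 \<le> B" "rnd n < rnd B"
      using infinite_range unfolding infinite_nat_iff_unbounded by fastforce
    define k where "k = (GREATEST k. rnd k \<le> rnd n)"
    have bound: "k \<le> B" if "rnd k \<le> rnd n" for k
      using that B rnd_mono[of B k] by linarith
    have kn: "rnd k \<le> rnd n" "n \<le> k"
      unfolding k_def using GreatestI_nat[of "\<lambda>k. rnd k \<le> rnd n" n B, OF _ bound]
        Greatest_le_nat[of "\<lambda>k. rnd k \<le> rnd n" n B, OF _ bound] by simp_all
    have "\<not> rnd (Suc k) \<le> rnd n"
      using Greatest_le_nat[of "\<lambda>k. rnd k \<le> rnd n" "Suc k" B, OF _ bound] unfolding k_def
      by (meson not_less_eq_eq order_refl)
    moreover have "rnd (Suc k) \<le> rnd k + 1" using steps_propagate[OF steps K, of k] n kn by simp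
    ultimately have "rnd (Suc k) = rnd K + Suc j" using kn n by simp
    then show ?case using kn n by (intro exI[of _ "Suc k"]) simp
  qed auto
  then have "{rnd K..} \<subseteq> rnd ` {K..}"
    by (metis atLeast_iff imageI le_Suc_ex subsetI)
  moreover have "rnd ` {K..} \<subseteq> rnd ` {1..}" "rnd ` {1..<K} \<subseteq> rnd ` {1..}"
    using K by (auto intro!: image_mono)
  ultimately show "rnd ` {1..<K} \<union> {rnd K..} \<subseteq> rnd ` {1..}" by blast
qed

text \<open>
  A discretization is certified by its first \<open>2 * K\<close> values, where \<open>K = length xs + 1\<close> is the first
  index whose value \<open>\<kappa>\<close> is repeated: from \<open>\<kappa>\<close> on every integer occurs, and \<open>\<kappa>\<close> bounds the collapse,
  so that closure and odd-filterability concern only the numbers in \<open>xs\<close>.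
\<close>

lemma discretization_from_table:
  assumes table: "\<forall>i<length ys. rnd (Suc i) = ys ! i"
    and ys: "ys = xs @ \<kappa> # \<kappa> # zs" "length zs = length xs"
    and sorted: "sorted_wrt (<) (xs @ [\<kappa>])"
    and steps: "successively (\<lambda>x y. y \<le> x + 1) (\<kappa> # zs)"
    and closed: "\<forall>x\<in>set xs. \<forall>y\<in>set xs. \<kappa> \<le> x + y \<or> x + y \<in> set xs"
    and odd: "\<forall>x\<in>set (every_other xs). \<forall>y\<in>set (every_other xs).
      \<kappa> \<le> x + y \<or> x + y \<in> set (every_other xs)"
  shows "discretization_with \<alpha> m (g ` {1..}) (set xs \<union> {\<kappa>..}) \<and>
    odd_filterable (set xs \<union> {\<kappa>..}) (g ` {1..}) m \<alpha>"
proof -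
  define N where "N = length xs"
  define S where "S = set xs \<union> {\<kappa>..}"
  have val_xs: "rnd (Suc i) = xs ! i" if "i < N" for i
    using table[rule_format, of i] that by (simp add: ys N_def nth_append)
  have val_\<kappa>: "rnd (Suc N) = \<kappa>" "rnd (Suc (Suc N)) = \<kappa>"
    using table[rule_format, of N] table[rule_format, of "Suc N"]
    by (simp_all add: ys N_def nth_append)
  have val_zs: "rnd (Suc (Suc N) + i) = (\<kappa> # zs) ! i" if "i \<le> N" for i
    using table[rule_format, of "Suc N + i"] that by (simp add: ys N_def nth_append)
  have step: "rnd (Suc n) \<le> rnd n + 1" if n: "Suc N \<le> n" "n < 2 * Suc N" for n
  proof (cases "n = Suc N")
    case False
    define i where "i = n - Suc (Suc N)"
    have i: "n = Suc (Suc N) + i" "i < N" using False n unfolding i_def by auto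
    have "(\<kappa> # zs) ! Suc i \<le> (\<kappa> # zs) ! i + 1"
      using steps i ys unfolding successively_conv_nth N_def by simp
    then show ?thesis using val_zs[of i] val_zs[of "Suc i"] i by simp
  qed (use val_\<kappa> in simp)
  have "rnd ` {1..<Suc N} = (\<lambda>i. rnd (Suc i)) ` {..<N}"
    unfolding image_Suc_lessThan[of N, folded atLeastLessThanSuc_atLeastAtMost, symmetric] image_image ..
  also have "\<dots> = set xs"
    using val_xs by (auto simp: N_def in_set_conv_nth image_iff)
  finally have range: "rnd ` {1..} = S"
    using range_eq_prefix_union[of "Suc N", OF step] val_\<kappa> unfolding S_def by simp
  have strict: "rnd n < rnd (Suc n)" if "1 \<le> n" "n < Suc N" for n
  proof -
    have "rnd n = (xs @ [\<kappa>]) ! (n - 1)" "rnd (Suc n) = (xs @ [\<kappa>]) ! n"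
      using val_xs[of "n - 1"] val_xs[of n] val_\<kappa> that by (auto simp: nth_append N_def less_Suc_eq)
    then show ?thesis
      using sorted_wrt_nth_less[OF sorted, of "n - 1" n] that by (simp add: N_def)
  qed
  have enum: "enumerate S j = rnd (Suc j)" if "j \<le> N" for j
    using enumerate_rnd[where N = "Suc N" and n = "Suc j", OF strict] that unfolding range by simp
  have inf: "infinite S" using infinite_range unfolding range .
  have odd_iff: "odd_index S a \<longleftrightarrow> a \<in> set (every_other xs)" if "a < \<kappa>" for a
  proof
    assume "odd_index S a"
    then obtain i where i: "1 \<le> i" "odd i" "a = enumerate S (i - 1)"
      unfolding odd_index_def by blast
    have "i - 1 < N"
    proof (rule ccontr)
      assume "\<not> i - 1 < N"
      then have "enumerate S N \<le> a" using enumerate_mono_le_iff[OF inf] i(3) by simp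
      then show False using enum[of N] val_\<kappa> that by simp
    qed
    then show "a \<in> set (every_other xs)"
      unfolding in_set_every_other using i enum[of "i - 1"] val_xs[of "i - 1"] N_def
      by (intro exI[of _ "i - 1"]) simp
  next
    assume "a \<in> set (every_other xs)"
    then obtain j where "j < N" "even j" "a = xs ! j"
      unfolding in_set_every_other N_def by blast
    then show "odd_index S a"
      unfolding odd_index_def using enum[of j] val_xs[of j] by (intro exI[of _ "Suc j"]) simp
  qed
  have closed_S: "x + y \<in> S" if "x \<in> S" "y \<in> S" for x y
    using that closed unfolding S_def by force
  have zero: "0 \<in> S" unfolding range[symmetric] using rnd_one by (metis atLeast_iff imageI order_refl)
  have "- S \<subseteq> {..<\<kappa>}" unfolding S_def by auto
  then have "finite (- S)" using finite_subset by blast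
  then have "numerical_semigroup S"
    unfolding numerical_semigroup_def using closed_S zero by blast
  then have disc: "discretization_with \<alpha> m (g ` {1..}) S"
    using discretization_iff range by simp
  have "collapse (g ` {1..}) m \<alpha> \<le> int \<kappa>"
    using collapse_le[of "Suc N"] val_\<kappa> by simp
  then have "odd_filterable S (g ` {1..}) m \<alpha>"
    unfolding odd_filterable_def using closed_S odd odd_iff
    by (smt (verit) le_add1 le_add2 le_less_trans not_le of_nat_mono order_trans)
  then show ?thesis using disc unfolding S_def by simp
qed

end
section \<open>The logarithmic monoid\<close>

lemma log_monoid_eq: "log_monoid = (\<lambda>n. log 2 (real n)) ` {1..}"
  unfolding log_monoid_def by auto

lemma rounded_doubling_log:
  assumes "0 \<le> \<alpha>" "\<alpha> \<le> 1" "1 \<le> m"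
  shows "rounded_doubling (\<lambda>n. log 2 (real n)) \<alpha> m"
  by unfold_locales (use assms in \<open>simp_all add: log_mult\<close>)

text \<open>
  With the threshold \<open>\<alpha> = log 2 (c / d)\<close> the inequalities that decide how \<open>m * log 2 n\<close> is rounded
  become inequalities between natural numbers of moderate size. For a rational \<open>\<alpha>\<close> the denominator would
  enter the exponents.
\<close>

lemma rounded_log_eq:
  assumes "d < c" "c \<le> 2 * d" "1 \<le> n"
    and lower: "c * 2 ^ s \<le> (2 * d * n ^ m :: nat)"
    and upper: "d * n ^ m < (c * 2 ^ s :: nat)"
  shows "rounded (\<lambda>n. log 2 (real n)) (log 2 (real c / real d)) m n = s"
proof -
  let ?x = "real m * log 2 (real n)" and ?\<alpha> = "log 2 (real c / real d)"
  have pos: "0 < c" "0 < d" using assms by auto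
  have "log 2 (real (c * 2 ^ s)) \<le> log 2 (real (2 * d * n ^ m))"
    using lower pos assms(3) by (subst log_le_cancel_iff) (auto simp del: of_nat_power of_nat_mult)
  then have l: "real s - 1 + ?\<alpha> \<le> ?x"
    using pos assms(3) by (simp add: log_mult log_nat_power log_divide)
  have "log 2 (real (d * n ^ m)) < log 2 (real (c * 2 ^ s))"
    using upper pos assms(3) by (subst log_less_cancel_iff) (auto simp del: of_nat_power of_nat_mult)
  then have u: "?x < real s + ?\<alpha>"
    using pos assms(3) by (simp add: log_mult log_nat_power log_divide)
  have "0 < ?\<alpha>" "?\<alpha> \<le> 1"
    using assms(1,2) pos by (simp_all add: divide_simps)
  then have "floor_alpha ?\<alpha> ?x = int s"
    by (intro floor_alpha_eq) (use l u in simp_all)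
  then show ?thesis by (simp add: rounded_def)
qed

fun log_table :: "nat \<Rightarrow> nat \<Rightarrow> nat \<Rightarrow> nat \<Rightarrow> nat list \<Rightarrow> bool" where
  "log_table m c d n [] \<longleftrightarrow> True"
| "log_table m c d n (s # ys) \<longleftrightarrow>
     c * 2 ^ s \<le> 2 * d * n ^ m \<and> d * n ^ m < c * 2 ^ s \<and> log_table m c d (n + 1) ys"

lemma log_table_sound:
  assumes "log_table m c d n ys" "d < c" "c \<le> 2 * d" "1 \<le> n"
  shows "\<forall>i<length ys.
    rounded (\<lambda>n. log 2 (real n)) (log 2 (real c / real d)) m (n + i) = ys ! i"
  using assms
proof (induction m c d n ys rule: log_table.induct)
  case (2 m c d n s ys)
  show ?case
  proof (intro allI impI)
    fix i assume i: "i < length (s # ys)"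
    show "rounded (\<lambda>n. log 2 (real n)) (log 2 (real c / real d)) m (n + i) = (s # ys) ! i"
    proof (cases i)
      case 0
      then show ?thesis using 2 rounded_log_eq[of d c n s m] by simp
    next
      case (Suc j)
      then show ?thesis using 2 i by simp
    qed
  qed
qed simp

section \<open>The golden fractal monoid\<close>

text \<open>
  The increasing enumeration of the golden fractal monoid. Passing from one period to the next keeps
  every offset (even indices) and divides every gap between neighbours in the golden ratio (odd
  indices).
\<close>

function gold :: "nat \<Rightarrow> real" where
  "gold n = (if n \<le> 1 then 0
     else if even n then gold (n div 2) + 1
     else gold (n div 2) + 1 + (golden - 1) * (gold (n div 2 + 1) - gold (n div 2)))"
  by auto
termination by (relation "measure id") (auto elim: oddE)

declare gold.simps [simp del]

lemma gold_one: "gold (Suc 0) = 0"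
  by (simp add: gold.simps)

lemma gold_double: "1 \<le> n \<Longrightarrow> gold (2 * n) = gold n + 1"
  by (subst gold.simps) simp

lemma gold_odd:
  "1 \<le> n \<Longrightarrow> gold (2 * n + 1) = gold n + 1 + (golden - 1) * (gold (n + 1) - gold n)"
  by (subst gold.simps) simp

lemma golden_squared: "golden * golden = golden + 1"
proof -
  have "sqrt 5 * sqrt 5 = (5::real)" by simp
  then show ?thesis unfolding golden_def by (simp add: field_simps)
qed

lemma golden_bounds: "1618033 / 1000000 < golden" "golden < 1618034 / 1000000"
proof -
  have "sqrt 5 > sqrt ((2236067 / 1000000)^2)" "sqrt 5 < sqrt ((2236068 / 1000000)^2)"
    by (intro real_sqrt_less_mono; simp add: power2_eq_square)+
  then show "1618033 / 1000000 < golden" "golden < 1618034 / 1000000"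
    unfolding golden_def real_sqrt_abs by simp_all
qed

lemma gold_less: "1 \<le> n \<Longrightarrow> gold n < gold (Suc n)"
proof (induction n rule: less_induct)
  case (less n)
  define k where "k = n div 2"
  show ?case
  proof (cases "n = 1")
    case True
    then show ?thesis using gold_double[of 1] gold_one by (simp add: numeral_2_eq_2)
  next
    case False
    then have k: "1 \<le> k" "k < n" using less.prems unfolding k_def by auto
    then have gap: "0 < gold (k + 1) - gold k" using less.IH[of k] by simp
    show ?thesis
    proof (cases "even n")
      case True
      then have "n = 2 * k" unfolding k_def by simp
      moreover have "0 < (golden - 1) * (gold (k + 1) - gold k)"
        using gap golden_bounds by (intro mult_pos_pos) auto
      ultimately show ?thesis using gold_odd[of k] gold_double[of k] k by simp
    next
      case False
      then have "n = 2 * k + 1" "Suc n = 2 * (k + 1)" unfolding k_def by simp_all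
      moreover have "0 < (2 - golden) * (gold (k + 1) - gold k)"
        using gap golden_bounds by (intro mult_pos_pos) auto
      ultimately show ?thesis using gold_odd[of k] gold_double[of "k + 1"] k
        by (simp add: algebra_simps)
    qed
  qed
qed

lemma rounded_doubling_gold:
  assumes "0 \<le> \<alpha>" "\<alpha> \<le> 1" "1 \<le> m"
  shows "rounded_doubling gold \<alpha> m"
  by unfold_locales (use assms gold_one gold_less gold_double in simp_all)

lemma gold_power: "gold (2 ^ k) = real k"
  by (induction k) (simp_all add: gold_double gold_one)

lemma sorted_list_of_set_image_strict_mono:
  fixes h :: "nat \<Rightarrow> 'a::linorder"
  assumes "\<And>i. h i < h (Suc i)"
  shows "sorted_list_of_set (h ` {..<N}) = map h [0..<N]"
proof -
  have mono: "strict_mono h" using assms by (simp add: strict_mono_Suc_iff)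
  then have "sorted (map h [0..<N])" "distinct (map h [0..<N])"
    by (auto simp: sorted_map strict_mono_less_eq distinct_map sorted_wrt_iff_nth_less
        intro: inj_on_subset[OF strict_mono_imp_inj_on[of h UNIV]])
  then have "sorted_list_of_set (set (map h [0..<N])) = map h [0..<N]"
    by (rule sorted_list_of_set.idem_if_sorted_distinct)
  then show ?thesis by (simp add: lessThan_atLeast0)
qed

lemma dyadic_block: "{2 ^ k..<2 ^ Suc k} = (\<lambda>r. 2 ^ k + r) ` {..<2 ^ k :: nat}"
  using image_add_atLeastLessThan[of "2 ^ k" 0 "2 ^ k :: nat"]
  by (simp add: lessThan_atLeast0 mult_2)

text \<open>
  The extra offset 1 at \<open>r = 2 ^ k\<close> stands for the first element of the next period, so that the
  last gap of a period is covered by the same formula as the others.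
\<close>

lemma offset_gold:
  assumes "r \<le> 2 ^ k"
  shows "offset k (gold ` {2 ^ k..<2 ^ Suc k}) r = gold (2 ^ k + r) - real k"
proof (cases "r < 2 ^ k")
  case True
  have "(\<lambda>x. x - real k) ` gold ` {2 ^ k..<2 ^ Suc k} = (\<lambda>r. gold (2 ^ k + r) - real k) ` {..<2 ^ k}"
    unfolding dyadic_block image_image ..
  moreover have "sorted_list_of_set ((\<lambda>r. gold (2 ^ k + r) - real k) ` {..<2 ^ k})
      = map (\<lambda>r. gold (2 ^ k + r) - real k) [0..<2 ^ k]"
    by (rule sorted_list_of_set_image_strict_mono) (simp add: gold_less Suc_le_eq)
  ultimately show ?thesis using True unfolding offset_def by simp
next
  case False
  then have "r = 2 ^ k" using assms by simp
  then show ?thesis using gold_power[of "Suc k"] unfolding offset_def by (simp add: mult_2)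
qed

lemma golden_period_eq: "golden_period (Suc k) = gold ` {2 ^ Suc k..<2 ^ Suc (Suc k)}"
proof (induction k)
  case 0
  have "{2..<4::nat} = {2, 3}" by auto
  moreover have "gold 2 = 1" "gold 3 = golden"
    using gold_double[of 1] gold_odd[of 1] gold_one by (simp_all add: eval_nat_numeral)
  ultimately show ?case by simp
next
  case (Suc k)
  define i where "i = Suc k"
  define \<tau> where "\<tau> = offset i (golden_period i)"
  have \<tau>: "\<tau> r = gold (2 ^ i + r) - real i" if "r \<le> 2 ^ i" for r
    unfolding \<tau>_def i_def Suc.IH using offset_gold[of r "Suc k"] that i_def by simp
  have piece: "{real (i + 1) + \<tau> r, real (i + 1) + \<tau> r + (golden - 1) * (\<tau> (r + 1) - \<tau> r)}
      = gold ` {2 * (2 ^ i + r), 2 * (2 ^ i + r) + 1}" if "r < 2 ^ i" for r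
    using gold_double[of "2 ^ i + r"] gold_odd[of "2 ^ i + r"] \<tau>[of r] \<tau>[of "r + 1"] that
    by (simp add: add_ac)
  have "{2 ^ Suc i..<2 ^ Suc (Suc i)} = (\<Union>r<2 ^ i. {2 * (2 ^ i + r), 2 * (2 ^ i + r) + 1 :: nat})"
    (is "?l = ?r")
  proof
    show "?l \<subseteq> ?r"
    proof
      fix n assume n: "n \<in> ?l"
      have "n = 2 * (2 ^ i + (n div 2 - 2 ^ i)) \<or> n = 2 * (2 ^ i + (n div 2 - 2 ^ i)) + 1"
        "n div 2 - 2 ^ i < 2 ^ i" using n by auto
      then show "n \<in> ?r" by blast
    qed
  qed auto
  then have "gold ` {2 ^ Suc i..<2 ^ Suc (Suc i)} = (\<Union>r<2 ^ i. gold ` {2 * (2 ^ i + r), 2 * (2 ^ i + r) + 1})"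
    by (simp add: image_UN)
  also have "\<dots> = (\<Union>r\<in>{0..2 ^ i - 1}. {real (i + 1) + \<tau> r,
           real (i + 1) + \<tau> r + (golden - 1) * (\<tau> (r + 1) - \<tau> r)})"
  proof (rule SUP_cong)
    have "Suc (2 ^ i - 1) = (2 ^ i :: nat)" by simp
    then show "{..<2 ^ i} = {0..2 ^ i - 1 :: nat}"
      by (metis atLeast0AtMost lessThan_Suc_atMost)
    fix r :: nat assume "r \<in> {0..2 ^ i - 1}"
    then have "r < 2 ^ i" 
      using \<open>Suc (2 ^ i - 1) = (2 ^ i :: nat)\<close> unfolding atLeastAtMost_iff by linarith
    then show "gold ` {2 * (2 ^ i + r), 2 * (2 ^ i + r) + 1} = {real (i + 1) + \<tau> r,
        real (i + 1) + \<tau> r + (golden - 1) * (\<tau> (r + 1) - \<tau> r)}"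
      by (rule piece[symmetric])
  qed
  finally show ?case unfolding \<tau>_def i_def by (simp add: Let_def)
qed

lemma golden_fractal_monoid_eq: "golden_fractal_monoid = gold ` {1..}"
proof -
  have "gold ` {1..} = {0} \<union> gold ` {2..}"
  proof -
    have "{1..} = insert (Suc 0) {2..}" by auto
    then show ?thesis using gold_one by simp
  qed
  moreover have "{2..} = (\<Union>k. {2 ^ Suc k..<2 ^ Suc (Suc k) :: nat})"
  proof
    show "{2..} \<subseteq> (\<Union>k. {2 ^ Suc k..<2 ^ Suc (Suc k) :: nat})"
    proof
      fix n :: nat assume n: "n \<in> {2..}"
      define j where "j = (LEAST j. n < 2 ^ j)"
      have ex: "n < 2 ^ n" by (rule less_exp)
      have j: "n < 2 ^ j" unfolding j_def by (rule LeastI[of _ n]) (rule ex)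
      have "2 \<le> j"
      proof (rule ccontr)
        assume "\<not> 2 \<le> j"
        then have "j = 0 \<or> j = 1" by auto
        then show False using j n by auto
      qed
      then obtain k where k: "j = Suc (Suc k)" by (metis Suc_le_D numeral_2_eq_2 Suc_le_mono)
      have "\<not> n < 2 ^ Suc k" using not_less_Least[of "Suc k" "\<lambda>j. n < 2 ^ j"] k unfolding j_def by simp
      then have "n \<in> {2 ^ Suc k..<2 ^ Suc (Suc k)}" using j k by simp
      then show "n \<in> (\<Union>k. {2 ^ Suc k..<2 ^ Suc (Suc k)})" by blast
    qed
    show "(\<Union>k. {2 ^ Suc k..<2 ^ Suc (Suc k) :: nat}) \<subseteq> {2..}"
    proof
      fix n :: nat assume "n \<in> (\<Union>k. {2 ^ Suc k..<2 ^ Suc (Suc k)})"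
      then obtain k where "2 * 2 ^ k \<le> n" by auto
      moreover have "1 \<le> (2::nat) ^ k" by simp
      ultimately show "n \<in> {2..}" unfolding atLeast_iff by linarith
    qed
  qed
  moreover have "(\<Union>i\<in>{1..}. golden_period i) = (\<Union>k. golden_period (Suc k))"
  proof -
    have "{1..} = range Suc" by (auto simp: image_iff Suc_le_eq gr0_conv_Suc)
    then show ?thesis by (metis image_image)
  qed
  ultimately show ?thesis
    unfolding golden_fractal_monoid_def golden_period_eq by (simp only: image_UN)
qed

text \<open>
  All values of \<open>gold\<close> lie in \<open>\<int> + \<int> \<phi>\<close>, where \<open>\<phi> * \<phi> = \<phi> + 1\<close> lets one compute exactly: in the odd case
  \<open>(\<phi> - 1) * (x + y * \<phi>) = (y - x) + x * \<phi>\<close>.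
\<close>

function gold_coords :: "nat \<Rightarrow> int \<times> int" where
  "gold_coords n = (if n \<le> 1 then (0, 0) else
     case gold_coords (n div 2) of (a, b) \<Rightarrow>
       if even n then (a + 1, b) else
         case gold_coords (n div 2 + 1) of (c, d) \<Rightarrow> (a + 1 + (d - b) - (c - a), b + (c - a)))"
  by auto
termination by (relation "measure id") (auto elim: oddE)

declare gold_coords.simps [simp del]

lemma gold_eq_coords: "gold_coords n = (a, b) \<Longrightarrow> gold n = of_int a + of_int b * golden"
proof (induction n arbitrary: a b rule: gold_coords.induct)
  case (1 n)
  obtain a' b' where ab: "gold_coords (n div 2) = (a', b')" by (cases "gold_coords (n div 2)")
  obtain c d where cd: "gold_coords (n div 2 + 1) = (c, d)" by (cases "gold_coords (n div 2 + 1)")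
  show ?case
  proof (cases "n \<le> 1")
    case True
    then show ?thesis using 1(3) by (simp add: gold.simps[of n] gold_coords.simps[of n])
  next
    case n: False
    note h = 1(1)[OF n ab]
    show ?thesis
    proof (cases "even n")
      case True
      then show ?thesis using 1(3) n ab h
        by (simp add: gold.simps[of n] gold_coords.simps[of n] algebra_simps)
    next
      case False
      have k: "gold (n div 2 + 1) = of_int c + of_int d * golden"
        using 1(2)[OF n ab[symmetric] False cd] .
      have "gold n = gold (n div 2) + 1 + (golden - 1) * (gold (n div 2 + 1) - gold (n div 2))"
        using n False by (simp add: gold.simps[of n])
      also have "\<dots> = of_int a' + of_int b' * golden + 1 + of_int (c - a') * (golden - 1)
          + of_int (d - b') * (golden * golden - golden)"
        unfolding h k by (simp add: algebra_simps)
      also have "\<dots> = of_int (a' + 1 + (d - b') - (c - a')) + of_int (b' + (c - a')) * golden"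
        unfolding golden_squared by (simp add: algebra_simps)
      finally have "gold n = \<dots>" .
      moreover have "a' + 1 + (d - b') - (c - a') = a" "b' + (c - a') = b"
        using 1(3) n False ab cd by (simp_all add: gold_coords.simps[of n])
      ultimately show ?thesis by simp
    qed
  qed
qed

lemmas gold_coords_numeral = gold_coords.simps[of "numeral k" for k] gold_coords.simps[of 1]

text \<open>
  The coordinates turn rounding decisions into integer inequalities, given decimal bounds for the golden
  ratio. Since the coefficient of the golden ratio may be negative, both bounds have to be tried.
\<close>

fun gold_table :: "nat \<Rightarrow> nat \<Rightarrow> nat \<Rightarrow> nat \<Rightarrow> nat list \<Rightarrow> bool" where
  "gold_table m p q n [] \<longleftrightarrow> True"
| "gold_table m p q n (s # ys) \<longleftrightarrow>
     (case gold_coords n of (a, b) \<Rightarrow>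
       1000000 * (int q * int s + int p - int q)
         \<le> int (m * q) * (1000000 * a + min (1618033 * b) (1618034 * b)) \<and>
       int (m * q) * (1000000 * a + max (1618033 * b) (1618034 * b))
         < 1000000 * (int q * int s + int p)) \<and>
     gold_table m p q (n + 1) ys"

lemma rounded_gold_eq:
  assumes pq: "0 < p" "p \<le> q"
    and ab: "gold_coords n = (a, b)"
    and lower: "1000000 * (int q * int s + int p - int q)
         \<le> int (m * q) * (1000000 * a + min (1618033 * b) (1618034 * b))"
    and upper: "int (m * q) * (1000000 * a + max (1618033 * b) (1618034 * b))
         < 1000000 * (int q * int s + int p)"
  shows "rounded gold (real p / real q) m n = s"
proof -
  let ?x = "real m * gold n"
  have q: "0 < real q" using assms by simp
  have b: "of_int (min (1618033 * b) (1618034 * b)) \<le> 1000000 * (of_int b * golden)"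
      "1000000 * (of_int b * golden) \<le> of_int (max (1618033 * b) (1618034 * b))"
  proof -
    have *: "1618033 * of_int b \<le> 1000000 * (of_int b * golden) \<and>
        1000000 * (of_int b * golden) \<le> 1618034 * of_int b \<or>
      1618034 * of_int b \<le> 1000000 * (of_int b * golden) \<and>
        1000000 * (of_int b * golden) \<le> 1618033 * of_int b"
    proof (cases "0 \<le> b")
      case True
      then show ?thesis
        using mult_left_mono[of "1618033 / 1000000" golden "of_int b"]
          mult_left_mono[of golden "1618034 / 1000000" "of_int b"] golden_bounds
        by (simp add: ac_simps)
    next
      case False
      then show ?thesis
        using mult_left_mono_neg[of "1618033 / 1000000" golden "of_int b"]
          mult_left_mono_neg[of golden "1618034 / 1000000" "of_int b"] golden_bounds
        by (simp add: ac_simps)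
    qed
    then show "of_int (min (1618033 * b) (1618034 * b)) \<le> 1000000 * (of_int b * golden)"
      "1000000 * (of_int b * golden) \<le> of_int (max (1618033 * b) (1618034 * b))"
      unfolding of_int_min of_int_max of_int_mult of_int_numeral by linarith+
  qed
  have mq: "0 \<le> real (m * q)" by simp
  have "1000000 * (real q * real s + real p - real q)
      \<le> real (m * q) * (1000000 * of_int a + of_int (min (1618033 * b) (1618034 * b)))"
    using lower[THEN of_int_le_iff[where 'a = real, THEN iffD2]] by simp
  also have "\<dots> \<le> real (m * q) * (1000000 * gold n)"
    using b(1) unfolding gold_eq_coords[OF ab] by (intro mult_left_mono mq) simp
  finally have "real q * (real s + real p / real q - 1) \<le> real q * ?x"
    using q by (simp add: algebra_simps)
  then have l: "real s - 1 + real p / real q \<le> ?x" using q by simp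
  have "real (m * q) * (1000000 * gold n)
      \<le> real (m * q) * (1000000 * of_int a + of_int (max (1618033 * b) (1618034 * b)))"
    using b(2) unfolding gold_eq_coords[OF ab] by (intro mult_left_mono mq) simp
  also have "\<dots> < 1000000 * (real q * real s + real p)"
    using upper[THEN of_int_less_iff[where 'a = real, THEN iffD2]] by simp
  finally have "real q * ?x < real q * (real s + real p / real q)"
    using q by (simp add: algebra_simps)
  then have u: "?x < real s + real p / real q" using q by simp
  have "floor_alpha (real p / real q) ?x = int s"
    by (rule floor_alpha_eq) (use assms l u in simp_all)
  then show ?thesis by (simp add: rounded_def)
qed

lemma gold_table_sound:
  assumes "gold_table m p q n ys" "0 < p" "p \<le> q"
  shows "\<forall>i<length ys. rounded gold (real p / real q) m (n + i) = ys ! i"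
  using assms
proof (induction m p q n ys rule: gold_table.induct)
  case (2 m p q n s ys)
  show ?case
  proof (intro allI impI)
    fix i assume i: "i < length (s # ys)"
    show "rounded gold (real p / real q) m (n + i) = (s # ys) ! i"
    proof (cases i)
      case 0
      obtain a b where ab: "gold_coords n = (a, b)" by (cases "gold_coords n")
      have "rounded gold (real p / real q) m n = s"
        using 2(2) by (intro rounded_gold_eq[OF 2(3,4) ab]) (simp_all only: gold_table.simps ab prod.case)
      then show ?thesis using 0 by simp
    next
      case (Suc j)
      have "gold_table m p q (n + 1) ys" using 2(2) by (simp only: gold_table.simps)
      then show ?thesis using 2(1)[OF _ 2(3,4)] Suc i by simp
    qed
  qed
qed simp

section \<open>The ten admissible multiplicities\<close>

definition admissible :: "nat \<Rightarrow> bool" where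
  "admissible m \<longleftrightarrow> (\<exists>S \<alpha>\<^sub>L \<alpha>\<^sub>F.
            discretization_with \<alpha>\<^sub>L m log_monoid S \<and>
            discretization_with \<alpha>\<^sub>F m golden_fractal_monoid S \<and>
            odd_filterable S log_monoid m \<alpha>\<^sub>L \<and>
            odd_filterable S golden_fractal_monoid m \<alpha>\<^sub>F)"

lemma admissible_from_tables:
  assumes L: "log_table m c d 1 (xs @ \<kappa> # \<kappa> # zs)" "d < c" "c \<le> 2 * d"
      "length zs = length xs" "successively (\<lambda>x y. y \<le> x + 1) (\<kappa> # zs)"
    and F: "gold_table m p q 1 (xs @ \<kappa> # \<kappa> # zs')" "0 < p" "p \<le> q"
      "length zs' = length xs" "successively (\<lambda>x y. y \<le> x + 1) (\<kappa> # zs')"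
    and sorted: "sorted_wrt (<) (xs @ [\<kappa>])"
    and closed: "\<forall>x\<in>set xs. \<forall>y\<in>set xs. \<kappa> \<le> x + y \<or> x + y \<in> set xs"
    and odd: "\<forall>x\<in>set (every_other xs). \<forall>y\<in>set (every_other xs).
      \<kappa> \<le> x + y \<or> x + y \<in> set (every_other xs)"
    and m: "1 \<le> m"
  shows "admissible m"
proof -
  interpret L: rounded_doubling "\<lambda>n. log 2 (real n)" "log 2 (real c / real d)" m
    using L(2,3) m by (intro rounded_doubling_log) (simp_all add: divide_simps)
  interpret F: rounded_doubling gold "real p / real q" m
    using F m by (intro rounded_doubling_gold) auto
  have "\<forall>i<length (xs @ \<kappa> # \<kappa> # zs). L.rnd (Suc i) = (xs @ \<kappa> # \<kappa> # zs) ! i"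
    using log_table_sound[OF L(1-3)] by simp
  moreover have "\<forall>i<length (xs @ \<kappa> # \<kappa> # zs'). F.rnd (Suc i) = (xs @ \<kappa> # \<kappa> # zs') ! i"
    using gold_table_sound[OF F(1-3)] by simp
  ultimately show ?thesis
    using L.discretization_from_table[OF _ refl L(4) sorted L(5) closed odd]
      F.discretization_from_table[OF _ refl F(4) sorted F(5) closed odd]
    unfolding admissible_def log_monoid_eq golden_fractal_monoid_eq by blast
qed

text \<open>
  The tables below list the rounded values with index up to \<open>2 * K\<close>. In each case both sequences
  agree until their first repetition \<open>\<kappa>\<close>, which is therefore the collapse with respect to both
  monoids.
\<close>

lemma admissible_1: "admissible 1"
  by (rule admissible_from_tables[where c = 2 and d = 1 and p = 1 and q = 1
      and xs = "[0]"
      and \<kappa> = 1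
      and zs = "[2]"
      and zs' = "[2]"])
    (simp_all add: gold_coords_numeral del: One_nat_def)

lemma admissible_2: "admissible 2"
  by (rule admissible_from_tables[where c = 2 and d = 1 and p = 1 and q = 1
      and xs = "[0, 2, 3]"
      and \<kappa> = 4
      and zs = "[5, 5, 6]"
      and zs' = "[5, 5, 6]"])
    (simp_all add: gold_coords_numeral del: One_nat_def)

lemma admissible_3: "admissible 3"
  by (rule admissible_from_tables[where c = 3 and d = 2 and p = 2 and q = 3
      and xs = "[0, 3, 5, 6, 7]"
      and \<kappa> = 8
      and zs = "[9, 9, 10, 10, 11]"
      and zs' = "[9, 10, 10, 10, 11]"])
    (simp_all add: gold_coords_numeral del: One_nat_def)

lemma admissible_4: "admissible 4"
  by (rule admissible_from_tables[where c = 2 and d = 1 and p = 1 and q = 1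
      and xs = "[0, 4, 6, 8, 9, 10, 11]"
      and \<kappa> = 12
      and zs = "[13, 13, 14, 14, 15, 15, 16]"
      and zs' = "[13, 14, 14, 15, 15, 15, 16]"])
    (simp_all add: gold_coords_numeral del: One_nat_def)

lemma admissible_5: "admissible 5"
  by (rule admissible_from_tables[where c = 5 and d = 3 and p = 1 and q = 1
      and xs = "[0, 5, 8, 10, 11, 13, 14, 15]"
      and \<kappa> = 16
      and zs = "[17, 18, 18, 19, 19, 20, 20, 21]"
      and zs' = "[17, 18, 18, 19, 19, 20, 20, 21]"])
    (simp_all add: gold_coords_numeral del: One_nat_def)

text \<open>
  Multiplicity 6 forces a very small threshold. The third element is 9 or 10. It must not be 9, since
  18 is the eighth element; and for 20 to have an odd index, 19 must be absent, so that
  \<open>6 * log 2 9\<close>, which is about 19.02, has to be rounded up.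
\<close>

lemma admissible_6: "admissible 6"
  by (rule admissible_from_tables[where c = 75 and d = 74 and p = 1 and q = 3
      and xs = "[0, 6, 10, 12, 14, 16, 17, 18]"
      and \<kappa> = 20
      and zs = "[21, 22, 23, 23, 24, 24, 25, 26]"
      and zs' = "[21, 22, 23, 23, 24, 24, 25, 26]"])
    (simp_all add: gold_coords_numeral del: One_nat_def)

lemma admissible_7: "admissible 7"
  by (rule admissible_from_tables[where c = 5 and d = 3 and p = 1 and q = 1
      and xs = "[0, 7, 11, 14, 16, 18, 19, 21, 22, 23, 24, 25]"
      and \<kappa> = 26
      and zs = "[27, 28, 28, 29, 29, 30, 31, 31, 31, 32, 32, 33]"
      and zs' = "[27, 28, 29, 29, 30, 30, 31, 31, 32, 32, 32, 33]"])
    (simp_all add: gold_coords_numeral del: One_nat_def)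

lemma admissible_8: "admissible 8"
  by (rule admissible_from_tables[where c = 5 and d = 4 and p = 3 and q = 4
      and xs = "[0, 8, 13, 16, 19, 21, 23, 24, 26, 27, 28, 29, 30]"
      and \<kappa> = 31
      and zs = "[32, 33, 34, 34, 35, 35, 36, 36, 37, 37, 38, 38, 39]"
      and zs' = "[32, 33, 34, 34, 35, 36, 36, 36, 37, 37, 38, 38, 39]"])
    (simp_all add: gold_coords_numeral del: One_nat_def)

lemma admissible_10: "admissible 10"
  by (rule admissible_from_tables[where c = 4 and d = 3 and p = 1 and q = 1
      and xs = "[0, 10, 16, 20, 23, 26, 28, 30, 32, 33, 35, 36, 37, 38, 39, 40, 41, 42]"
      and \<kappa> = 43
      and zs = "[44, 45, 45, 46, 47, 47, 48, 48, 49, 49, 50, 50, 51, 51, 51, 52, 52, 53]"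
      and zs' = "[44, 45, 45, 46, 47, 47, 48, 48, 49, 49, 49, 50, 50, 51, 52, 52, 52, 53]"])
    (simp_all add: gold_coords_numeral del: One_nat_def)

lemma admissible_12: "admissible 12"
  by (rule admissible_from_tables[where c = 6 and d = 5 and p = 1 and q = 1
      and xs = "[0, 12, 19, 24, 28, 31, 34, 36, 38, 40, 42, 43, 45, 46, 47, 48, 49, 50, 51, 52, 53, 54]"
      and \<kappa> = 55
      and zs = "[56, 57, 57, 58, 59, 59, 60, 60, 61, 61, 62, 62, 63, 63, 64, 64, 65, 65, 65, 66, 66, 67]"
      and zs' = "[56, 57, 57, 58, 58, 59, 59, 60, 61, 61, 62, 62, 63, 63, 64, 64, 65, 65, 66, 66, 66, 67]"])
    (simp_all add: gold_coords_numeral del: One_nat_def)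

section \<open>Excluding all other multiplicities\<close>

lemma log2_gt: "1 \<le> n \<Longrightarrow> 0 < q \<Longrightarrow> 2 ^ p < (n ^ q :: nat) \<Longrightarrow> real p / real q < log 2 (real n)"
proof -
  assume *: "1 \<le> n" "0 < q" "2 ^ p < (n ^ q :: nat)"
  have "log 2 (real (2 ^ p)) < log 2 (real (n ^ q))"
    using * by (subst log_less_cancel_iff) (auto simp del: of_nat_power)
  then show ?thesis using * by (simp add: log_nat_power field_simps)
qed

lemma log2_lt: "1 \<le> n \<Longrightarrow> 0 < q \<Longrightarrow> (n ^ q :: nat) < 2 ^ p \<Longrightarrow> log 2 (real n) < real p / real q"
proof -
  assume *: "1 \<le> n" "0 < q" "(n ^ q :: nat) < 2 ^ p"
  have "log 2 (real (n ^ q)) < log 2 (real (2 ^ p))"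
    using * by (subst log_less_cancel_iff) (auto simp del: of_nat_power)
  then show ?thesis using * by (simp add: log_nat_power field_simps)
qed

lemma log2_bounds:
  "84 / 53 < log 2 (3::real)" "log 2 (3::real) < 233 / 147"
  "339 / 146 < log 2 (5::real)" "log 2 (5::real) < 137 / 59"
  "306 / 109 < log 2 (7::real)" "log 2 (7::real) < 379 / 135"
  "595 / 172 < log 2 (11::real)" "log 2 (11::real) < 128 / 37"
  using log2_gt[of 3 53 84] log2_lt[of 3 147 233] log2_gt[of 5 146 339] log2_lt[of 5 59 137]
    log2_gt[of 7 109 306] log2_lt[of 7 135 379] log2_gt[of 11 172 595] log2_lt[of 11 37 128]
  by simp_all

lemma log2_products:
  "log 2 (9::real) = 2 * log 2 3" "log 2 (10::real) = 1 + log 2 5"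
  "log 2 (21::real) = log 2 3 + log 2 7" "log 2 (22::real) = 1 + log 2 11"
  "log 2 (27::real) = 3 * log 2 3" "log 2 (28::real) = 2 + log 2 7"
  using log_mult[of 2 3 3] log_mult[of 2 2 5] log_mult[of 2 3 7]
    log_mult[of 2 2 11] log_mult[of 2 3 9] log_mult[of 2 4 7] log_pow_cancel[of 2 2]
  by simp_all

lemma gold_values:
  "gold 1 = 0" "gold 2 = 1" "gold 3 = golden" "gold 4 = 2" "gold 5 = 4 - golden"
  "gold 6 = 1 + golden" "gold 7 = 3 * golden - 2" "gold 8 = 3" "gold 9 = 2 * golden"
  "gold 10 = 5 - golden" "gold 11 = 10 - 4 * golden" "gold 20 = 6 - golden"
  "gold 21 = 4 * golden - 2"
  by (simp_all add: gold_eq_coords gold_coords_numeral del: One_nat_def)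

text \<open>
  The ratio \<open>(n + 1) / n\<close> decreases in \<open>n\<close>, so the largest index decides.
\<close>

lemma two_power_le_Suc_power_mono:
  fixes n N k :: nat
  assumes "2 * N ^ k \<le> (N + 1) ^ k" "1 \<le> n" "n \<le> N"
  shows "2 * n ^ k \<le> (n + 1) ^ k"
proof -
  have N: "0 < N" using assms by simp
  have "2 * n ^ k * N ^ k \<le> n ^ k * (N + 1) ^ k"
    using mult_left_mono[OF assms(1), of "n ^ k"] by (simp add: mult_ac)
  also have "\<dots> = (n * (N + 1)) ^ k" by (simp only: power_mult_distrib)
  also have "\<dots> \<le> ((n + 1) * N) ^ k" using assms by (intro power_mono) simp_all
  finally have "2 * n ^ k * N ^ k \<le> (n + 1) ^ k * N ^ k" by (simp only: power_mult_distrib)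
  then show ?thesis using N by simp
qed

text \<open>
  A gap of at least \<open>1 / k\<close> between neighbouring logarithms survives rounding after multiplication by
  \<open>m \<ge> k\<close>.
\<close>

lemma rounded_log_strict:
  assumes "rounded_doubling (\<lambda>n. log 2 (real n)) \<alpha> m"
    and N: "2 * N ^ k \<le> (N + 1) ^ k" "k \<le> m" and n: "1 \<le> n" "n \<le> N"
  shows "rounded (\<lambda>n. log 2 (real n)) \<alpha> m n < rounded (\<lambda>n. log 2 (real n)) \<alpha> m (Suc n)"
proof -
  interpret rounded_doubling "\<lambda>n. log 2 (real n)" \<alpha> m by fact
  have "log 2 (real (2 * n ^ k)) \<le> log 2 (real ((n + 1) ^ k))"
    using two_power_le_Suc_power_mono[OF N(1) n] n
    by (subst log_le_cancel_iff) (auto simp del: of_nat_power of_nat_mult of_nat_add)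
  then have "1 \<le> real k * (log 2 (real (Suc n)) - log 2 (real n))"
    using n by (simp add: log_mult log_nat_power right_diff_distrib del: of_nat_add of_nat_Suc)
  also have "\<dots> \<le> real m * (log 2 (real (Suc n)) - log 2 (real n))"
    using N(2) g_less[OF n(1)] by (intro mult_right_mono) simp_all
  finally show ?thesis by (rule rnd_strict[OF n(1)])
qed

locale common_discretization =
  fixes m :: nat and \<alpha> \<beta> :: real and S :: "nat set"
  assumes m9: "9 \<le> m"
    and disc_log: "discretization_with \<alpha> m log_monoid S"
    and disc_gold: "discretization_with \<beta> m golden_fractal_monoid S"
    and odd_filt: "odd_filterable S log_monoid m \<alpha>"
begin

sublocale L: rounded_doubling "\<lambda>n. log 2 (real n)" \<alpha> m
  using m9 disc_log by (intro rounded_doubling_log) (auto simp: discretization_with_def)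

sublocale F: rounded_doubling gold \<beta> m
  using m9 disc_gold by (intro rounded_doubling_gold) (auto simp: discretization_with_def)

abbreviation s where "s \<equiv> rounded (\<lambda>n. log 2 (real n)) \<alpha> m"
abbreviation t where "t \<equiv> rounded gold \<beta> m"

lemma S_eq: "S = s ` {1..}" "S = t ` {1..}"
  using disc_log disc_gold
  unfolding log_monoid_eq golden_fractal_monoid_eq L.discretization_iff F.discretization_iff
  by simp_all

lemma closed: "x \<in> S \<Longrightarrow> y \<in> S \<Longrightarrow> x + y \<in> S"
  using disc_log unfolding discretization_with_def numerical_semigroup_def by blast

lemma s_in: "1 \<le> n \<Longrightarrow> s n \<in> S"
  unfolding S_eq(1) by simp

lemma not_in_S: "1 \<le> n \<Longrightarrow> s n < x \<Longrightarrow> x < s (Suc n) \<Longrightarrow> x \<notin> S"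
proof
  assume n: "1 \<le> n" "s n < x" "x < s (Suc n)" and "x \<in> S"
  then obtain k where k: "1 \<le> k" "x = s k" unfolding S_eq(1) by auto
  show False
    using L.rnd_mono[of k n] L.rnd_mono[of "Suc n" k] n k by (cases "k \<le> n") auto
qed

lemma not_in_S': "1 \<le> n \<Longrightarrow> t n < x \<Longrightarrow> x < t (Suc n) \<Longrightarrow> x \<notin> S"
proof
  assume n: "1 \<le> n" "t n < x" "x < t (Suc n)" and "x \<in> S"
  then obtain k where k: "1 \<le> k" "x = t k" unfolding S_eq(2) by auto
  show False
    using F.rnd_mono[of k n] F.rnd_mono[of "Suc n" k] n k by (cases "k \<le> n") auto
qed

lemma s_strict: "1 \<le> n \<Longrightarrow> n \<le> 10 \<Longrightarrow> s n < s (Suc n)"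
  using rounded_log_strict[of \<alpha> m 10 9 n] m9 L.rounded_doubling_axioms by simp

lemma t_strict: "1 \<le> n \<Longrightarrow> n \<le> 10 \<Longrightarrow> t n < t (Suc n)"
proof -
  assume n: "1 \<le> n" "n \<le> 10"
  then have "n \<in> {1, 2, 3, 4, 5, 6, 7, 8, 9, 10}" unfolding insert_iff empty_iff by presburger
  then have gap: "1 / 9 \<le> gold (Suc n) - gold n"
    using gold_values golden_bounds by (elim insertE) (simp_all add: eval_nat_numeral)
  have "1 \<le> real m * (1 / 9)" using m9 by simp
  also have "\<dots> \<le> real m * (gold (Suc n) - gold n)"
    using gap by (intro mult_left_mono) simp_all
  finally show ?thesis by (rule F.rnd_strict[OF n(1)])
qed

text \<open>
  The first eleven elements of both monoids have gaps of at least \<open>1 / 9\<close>, so both sequences enumerate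
  the beginning of \<open>S\<close> without repetition.
\<close>

lemma agree:
  assumes "1 \<le> n" "n \<le> 11"
  shows "t n = s n"
proof -
  have "enumerate (s ` {1..}) (n - 1) = s n"
    by (rule L.enumerate_rnd[where N = 11]) (use s_strict assms in auto)
  moreover have "enumerate (t ` {1..}) (n - 1) = t n"
    by (rule F.enumerate_rnd[where N = 11]) (use t_strict assms in auto)
  ultimately show ?thesis using S_eq by simp
qed

lemma s_le: "1 \<le> n \<Longrightarrow> real m * log 2 (real n) \<le> real k \<Longrightarrow> s n \<le> k"
  using floor_alpha_le_ceiling[of \<alpha> "real m * log 2 (real n)"] L.int_rnd[of n] by linarith

lemma s_ge: "1 \<le> n \<Longrightarrow> real k \<le> real m * log 2 (real n) \<Longrightarrow> k \<le> s n"
  using floor_alpha_ge_floor[of "real m * log 2 (real n)" \<alpha>] L.int_rnd[of n] by linarith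

lemma t_ge: "1 \<le> n \<Longrightarrow> real k \<le> real m * gold n \<Longrightarrow> k \<le> t n"
  using floor_alpha_ge_floor[of "real m * gold n" \<beta>] F.int_rnd[of n] by linarith

lemma s_down: "1 \<le> n \<Longrightarrow> s n = k \<Longrightarrow> real k < real m * log 2 (real n) \<Longrightarrow> real m * log 2 (real n) < real k + \<alpha>"
  using less_if_rounded_down[of \<alpha> "real m * log 2 (real n)" "int k"] L.int_rnd[of n] by simp

lemma s_up: "1 \<le> n \<Longrightarrow> s n = k \<Longrightarrow> real m * log 2 (real n) < real k \<Longrightarrow> real k - 1 + \<alpha> \<le> real m * log 2 (real n)"
  using ge_if_rounded_up[of \<alpha> "real m * log 2 (real n)" "int k"] L.int_rnd[of n] by simp

lemma t_down: "1 \<le> n \<Longrightarrow> t n = k \<Longrightarrow> real k < real m * gold n \<Longrightarrow> real m * gold n < real k + \<beta>"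
  using less_if_rounded_down[of \<beta> "real m * gold n" "int k"] F.int_rnd[of n] by simp

lemma s_eq_above: "1 \<le> n \<Longrightarrow> real k \<le> real m * log 2 (real n) \<Longrightarrow> real m * log 2 (real n) < real k + \<alpha> \<Longrightarrow> s n = k"
  using floor_alpha_eq_if_above[of "int k" "real m * log 2 (real n)" \<alpha>] L.int_rnd[of n] L.alpha by simp

lemma s_eq_below: "1 \<le> n \<Longrightarrow> real k - 1 + \<alpha> \<le> real m * log 2 (real n) \<Longrightarrow>
    real k - 1 < real m * log 2 (real n) \<Longrightarrow> real m * log 2 (real n) \<le> real k \<Longrightarrow> s n = k"
  using floor_alpha_eq_if_below[of "int k" \<alpha> "real m * log 2 (real n)"] L.int_rnd[of n] by simp

lemma t_eq_above: "1 \<le> n \<Longrightarrow> real k \<le> real m * gold n \<Longrightarrow> real m * gold n < real k + \<beta> \<Longrightarrow> t n = k"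
  using floor_alpha_eq_if_above[of "int k" "real m * gold n" \<beta>] F.int_rnd[of n] F.alpha by simp

text \<open>
  If an interval from an integer to the next one fits between \<open>m * log 2 n\<close> and \<open>m * gold n\<close>, then
  no choice of thresholds lets their rounded values coincide.
\<close>

lemma no_separating_integer:
  assumes "1 \<le> n" "n \<le> 11" "real m * log 2 (real n) \<le> real k" "real (Suc k) \<le> real m * gold n"
  shows False
  using s_le[of n k] t_ge[of n "Suc k"] agree[of n] assms by simp

lemma odd_sum:
  assumes strict: "\<And>n. 1 \<le> n \<Longrightarrow> n < N \<Longrightarrow> s n < s (Suc n)"
    and ij: "1 \<le> i" "odd i" "i \<le> N" "1 \<le> j" "odd j" "j \<le> N"
    and k: "1 \<le> k" "k < N" "even k"
  shows "s i + s j \<noteq> s k"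
proof
  assume eq: "s i + s j = s k"
  have lt: "s p < s q" if "1 \<le> p" "p < q" "q \<le> N" for p q
    using L.rnd_mono[of "Suc p" q] strict[of p] that by simp
  have "odd_filterable (s ` {1..}) ((\<lambda>n. log 2 (real n)) ` {1..}) m \<alpha>"
    using odd_filt unfolding S_eq(1) log_monoid_eq .
  then obtain l where l: "l \<le> N" "odd l" "s k = s l"
    using L.odd_sum_has_odd_index[OF _ strict ij] lt[of k N] k eq by auto
  moreover have "1 \<le> l" using l by (cases l) auto
  ultimately show False using lt[of k l] lt[of l k] k by (cases l k rule: linorder_cases) auto
qed

text \<open>
  The index 11 is where \<open>gold n - log 2 n\<close> is largest among the first eleven; it exceeds \<open>2 / 30\<close>
  there, and two numbers that differ by 2 never round to the same integer.
\<close>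

lemma m_lt_30: "m < 30"
proof (rule ccontr)
  assume "\<not> m < 30"
  then have "30 * (10 - 4 * golden - log 2 11) \<le> real m * (10 - 4 * golden - log 2 11)"
    using log2_bounds golden_bounds by (intro mult_right_mono) auto
  then have "real m * log 2 11 + 2 \<le> real m * gold 11"
    using log2_bounds golden_bounds unfolding gold_values by (simp add: algebra_simps)
  then have "s 11 < t 11"
    using floor_alpha_less_if_gap_two[of "real m * log 2 11" "real m * gold 11" \<alpha> \<beta>]
      L.int_rnd[of 11] F.int_rnd[of 11] by simp
  then show False using agree[of 11] by simp
qed

text \<open>
  For each of these multiplicities such an interval exists at one of the indices 5, 9, 11.
\<close>

lemma m_notin_separated: "m \<notin> {17, 19, 21, 22, 23, 24, 25, 26, 27, 28, 29}"
  using no_separating_integer[of 9 54] no_separating_integer[of 11 66] no_separating_integer[of 5 49]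
    no_separating_integer[of 9 70] no_separating_integer[of 9 73] no_separating_integer[of 5 56]
    no_separating_integer[of 11 87] no_separating_integer[of 9 83] no_separating_integer[of 5 63]
    no_separating_integer[of 9 89] no_separating_integer[of 9 92]
    log2_bounds golden_bounds
  unfolding gold_values log2_products of_nat_numeral by auto

lemma twice_s3_in_S: "s 3 + s 3 \<in> S" by (intro closed s_in) simp_all

text \<open>
  Most of the remaining multiplicities are excluded by sums of two elements of odd index: according to the
  logarithms, the sum should be close to the element whose index is the product of the two indices.
  For 9, 11, 14 and 16 the double of the third element falls short of the ninth or exceeds it: it lands
  in a gap of \<open>S\<close> or, for 9, possibly on the tenth element, whose index is even.
\<close>

lemma m_ne_9: "m \<noteq> 9"
proof
  assume m: "m = 9"
  have "14 \<le> s 3" "s 3 \<le> 15" using s_ge[of 3 14] s_le[of 3 15] log2_bounds m by simp_all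
  then consider "s 3 = 14" | "s 3 = 15" by linarith
  then show False
  proof cases
    case 1
    have "s 8 = 27" using L.rnd_power[of 1 3] L.rnd_one m by simp
    moreover have "29 \<le> s 9" using t_ge[of 9 29] agree[of 9] golden_bounds m by (simp add: gold_values)
    ultimately show False using not_in_S[of 8 28] twice_s3_in_S 1 by simp
  next
    case 2
    have "s 10 \<le> 30" using s_le[of 10 30] log2_bounds m by (simp add: log2_products)
    moreover have "30 \<le> s 10" using t_ge[of 10 30] agree[of 10] golden_bounds m by (simp add: gold_values)
    ultimately have "s 10 = s 3 + s 3" using 2 by simp
    moreover have "s 3 + s 3 \<noteq> s 10" by (rule odd_sum[of 11]) (use s_strict in auto)
    ultimately show False by simp
  qed
qed

lemma m_ne_11: "m \<noteq> 11"
proof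
  assume m: "m = 11"
  have "17 \<le> s 3" "s 3 \<le> 18" using s_ge[of 3 17] s_le[of 3 18] log2_bounds m by simp_all
  then consider "s 3 = 17" | "s 3 = 18" by linarith
  then show False
  proof cases
    case 1
    have "s 8 = 33" using L.rnd_power[of 1 3] L.rnd_one m by simp
    moreover have "35 \<le> s 9" using t_ge[of 9 35] agree[of 9] golden_bounds m by (simp add: gold_values)
    ultimately show False using not_in_S[of 8 34] twice_s3_in_S 1 by simp
  next
    case 2
    have "s 9 \<le> 35" using s_le[of 9 35] log2_bounds m by (simp add: log2_products)
    moreover have "37 \<le> s 10" using t_ge[of 10 37] agree[of 10] golden_bounds m by (simp add: gold_values)
    ultimately show False using not_in_S[of 9 36] twice_s3_in_S 2 by simp
  qed
qed

text \<open>
  If the fifth element is 31, then adding it to the third gives 52, which is the sixteenth element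
  instead of the fifteenth. If it is 30, then both thresholds are so restricted that 57 is attained by
  the logarithms but skipped by the golden sequence.
\<close>

lemma m_ne_13: "m \<noteq> 13"
proof
  assume m: "m = 13"
  have s3: "s 3 = 21"
    using s_le[of 3 21] t_ge[of 3 21] agree[of 3] log2_bounds golden_bounds m by (simp add: gold_values)
  have "30 \<le> s 5" "s 5 \<le> 31" using s_ge[of 5 30] s_le[of 5 31] log2_bounds m by simp_all
  then consider "s 5 = 30" | "s 5 = 31" by linarith
  then show False
  proof cases
    case 1
    have \<alpha>: "13 * log 2 5 < 30 + \<alpha>" using s_down[of 5 30] 1 log2_bounds m by simp
    have "s 21 = 57"
      by (rule s_eq_above) (use log2_bounds \<alpha> m in \<open>simp_all add: log2_products\<close>)
    then have "57 \<in> S" using s_in[of 21] by simp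
    moreover have "t 20 = 56" using F.rnd_double[of 10] F.rnd_double[of 5] agree[of 5] 1 m by simp
    moreover have "58 \<le> t 21" using t_ge[of 21 58] golden_bounds m by (simp add: gold_values)
    ultimately show False using not_in_S'[of 20 57] by simp
  next
    case 2
    have "s 16 = 52" using L.rnd_power[of 1 4] L.rnd_one m by simp
    moreover have "s 3 + s 5 \<noteq> s 16"
    proof (rule odd_sum[of 17])
      show "s n < s (Suc n)" if "1 \<le> n" "n < 17" for n
        using rounded_log_strict[of \<alpha> m 16 13 n] L.rounded_doubling_axioms that m by simp
    qed simp_all
    ultimately show False using s3 2 by simp
  qed
qed

lemma m_ne_14: "m \<noteq> 14"
proof
  assume m: "m = 14"
  have "22 \<le> s 3" "s 3 \<le> 23" using s_ge[of 3 22] s_le[of 3 23] log2_bounds m by simp_all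
  then consider "s 3 = 22" | "s 3 = 23" by linarith
  then show False
  proof cases
    case 1
    have "s 8 = 42" using L.rnd_power[of 1 3] L.rnd_one m by simp
    moreover have "45 \<le> s 9" using t_ge[of 9 45] agree[of 9] golden_bounds m by (simp add: gold_values)
    ultimately show False using not_in_S[of 8 44] twice_s3_in_S 1 by simp
  next
    case 2
    have \<alpha>: "22 + \<alpha> \<le> 14 * log 2 3" using s_up[of 3 23] 2 log2_bounds m by simp
    have "s 9 \<le> 45" using s_le[of 9 45] log2_bounds m by (simp add: log2_products)
    moreover have "s 10 = 47"
      by (rule s_eq_below) (use log2_bounds \<alpha> m in \<open>simp_all add: log2_products\<close>)
    ultimately show False using not_in_S[of 9 46] twice_s3_in_S 2 by simp
  qed
qed

text \<open>
  The sum \<open>24 + 42 = 66\<close> of the third and the seventh element is skipped by the golden sequence, because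
  agreement at index 11 forces \<open>\<beta>\<close> to be so large that \<open>15 * gold 20\<close> is rounded down.
\<close>

lemma m_ne_15: "m \<noteq> 15"
proof
  assume m: "m = 15"
  have s3: "s 3 = 24"
    using s_le[of 3 24] t_ge[of 3 24] agree[of 3] log2_bounds golden_bounds m by (simp add: gold_values)
  have "t 11 = 52"
    using s_le[of 11 52] t_ge[of 11 52] agree[of 11] log2_bounds golden_bounds m by (simp add: gold_values)
  then have \<beta>: "150 - 60 * golden < 52 + \<beta>" using t_down[of 11 52] golden_bounds m by (simp add: gold_values)
  have "t 7 = 42"
    by (rule t_eq_above) (use golden_bounds \<beta> m in \<open>simp_all add: gold_values\<close>)
  then have "66 \<in> S" using closed[OF s_in[of 3] s_in[of 7]] s3 agree[of 7] by simp
  moreover have "t 20 = 65"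
    by (rule t_eq_above) (use golden_bounds \<beta> m in \<open>simp_all add: gold_values\<close>)
  moreover have "67 \<le> t 21" using t_ge[of 21 67] golden_bounds m by (simp add: gold_values)
  ultimately show False using not_in_S'[of 20 66] by simp
qed

lemma m_ne_16: "m \<noteq> 16"
proof
  assume m: "m = 16"
  have "s 5 = 38"
    using s_le[of 5 38] t_ge[of 5 38] agree[of 5] log2_bounds golden_bounds m by (simp add: gold_values)
  then have \<alpha>: "37 + \<alpha> \<le> 16 * log 2 5" using s_up[of 5 38] log2_bounds m by simp
  have "s 3 = 26"
    by (rule s_eq_below) (use log2_bounds \<alpha> m in simp_all)
  moreover have "s 9 \<le> 51" using s_le[of 9 51] log2_bounds m by (simp add: log2_products)
  moreover have "53 \<le> s 10" using s_ge[of 10 53] log2_bounds m by (simp add: log2_products)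
  ultimately show False using not_in_S[of 9 52] twice_s3_in_S by simp
qed

text \<open>
  Agreement at index 9 leaves only thresholds \<open>\<alpha> < 0.06\<close>, for which the third and the ninth element
  add up to the 28th. The general gap estimate yields strictness up to index 26 only, so the last steps
  are computed.
\<close>

lemma m_ne_18: "m \<noteq> 18"
proof
  assume m: "m = 18"
  have s9: "s 9 = 58"
    using s_le[of 9 58] t_ge[of 9 58] agree[of 9] log2_bounds golden_bounds m
    by (simp add: gold_values log2_products)
  then have \<alpha>: "57 + \<alpha> \<le> 36 * log 2 3" using s_up[of 9 58] log2_bounds m by (simp add: log2_products)
  have s3: "s 3 = 29"
    using s_le[of 3 29] t_ge[of 3 29] agree[of 3] log2_bounds golden_bounds m by (simp add: gold_values)
  have s26: "s 26 \<le> 85" using s_le[of 26 85] log2_lt[of 26 18 85] m by simp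
  have s27: "s 27 = 86"
    by (rule s_eq_below) (use log2_bounds \<alpha> m in \<open>simp_all add: log2_products\<close>)
  have s28: "s 28 = 87"
    by (rule s_eq_below) (use log2_bounds \<alpha> m in \<open>simp_all add: log2_products\<close>)
  have s29: "s 29 = 88"
    by (rule s_eq_below) (use log2_bounds \<alpha> m log2_gt[of 29 45 218] log2_lt[of 29 18 88] in simp_all)
  have "s 3 + s 9 \<noteq> s 28"
  proof (rule odd_sum[of 29])
    show "s n < s (Suc n)" if n: "1 \<le> n" "n < 29" for n
    proof (cases "n \<le> 25")
      case True
      then show ?thesis
        using rounded_log_strict[of \<alpha> m 25 18 n] L.rounded_doubling_axioms n m by simp
    next
      case False
      then have "n = 26 \<or> n = 27 \<or> n = 28" using n by auto
      then show ?thesis using s26 s27 s28 s29 by auto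
    qed
  qed simp_all
  then show False using s3 s9 s28 by simp
qed

text \<open>
  Agreement at index 7 makes \<open>\<alpha>\<close> so small that the sum \<open>32 + 57 = 89\<close> of the third and the seventh
  element is skipped by the logarithms between the indices 21 and 22.
\<close>

lemma m_ne_20: "m \<noteq> 20"
proof
  assume m: "m = 20"
  have s3: "s 3 = 32"
    using s_le[of 3 32] t_ge[of 3 32] agree[of 3] log2_bounds golden_bounds m by (simp add: gold_values)
  have s7: "s 7 = 57"
    using s_le[of 7 57] t_ge[of 7 57] agree[of 7] log2_bounds golden_bounds m by (simp add: gold_values)
  then have \<alpha>: "56 + \<alpha> \<le> 20 * log 2 7" using s_up[of 7 57] log2_bounds m by simp
  have "89 \<in> S" using closed[OF s_in[of 3] s_in[of 7]] s3 s7 by simp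
  moreover have "s 21 \<le> 88" using s_le[of 21 88] log2_bounds m by (simp add: log2_products)
  moreover have "s 22 = 90"
    by (rule s_eq_below) (use log2_bounds \<alpha> m in \<open>simp_all add: log2_products\<close>)
  ultimately show False using not_in_S[of 21 89] by simp
qed

lemma m_cases: "m \<in> {10, 12}"
proof -
  have "m \<in> {9, 10, 11, 12, 13, 14, 15, 16, 18, 20} \<union>
      {17, 19, 21, 22, 23, 24, 25, 26, 27, 28, 29}"
    using m9 m_lt_30 unfolding insert_iff Un_iff empty_iff by presburger
  then show ?thesis
    using m_notin_separated m_ne_9 m_ne_11 m_ne_13 m_ne_14 m_ne_15 m_ne_16 m_ne_18 m_ne_20 by blast
qed

end
section \<open>The characterization\<close>

theorem theorem7p2:
  fixes m :: nat
  assumes "1 \<le> m"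
  shows "(\<exists>S \<alpha>\<^sub>L \<alpha>\<^sub>F.
            discretization_with \<alpha>\<^sub>L m log_monoid S \<and>
            discretization_with \<alpha>\<^sub>F m golden_fractal_monoid S \<and>
            odd_filterable S log_monoid m \<alpha>\<^sub>L \<and>
            odd_filterable S golden_fractal_monoid m \<alpha>\<^sub>F)
         \<longleftrightarrow> m \<in> {1, 2, 3, 4, 5, 6, 7, 8, 10, 12}"
  (is "?lhs \<longleftrightarrow> _")
proof
  assume ?lhs
  then obtain S \<alpha> \<beta> where S: "discretization_with \<alpha> m log_monoid S"
      "discretization_with \<beta> m golden_fractal_monoid S" "odd_filterable S log_monoid m \<alpha>"
    by blast
  show "m \<in> {1, 2, 3, 4, 5, 6, 7, 8, 10, 12}"
  proof (cases "9 \<le> m")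
    case True
    then interpret common_discretization m \<alpha> \<beta> S
      using S by unfold_locales
    show ?thesis using m_cases by blast
  next
    case False
    then show ?thesis using assms unfolding insert_iff empty_iff by presburger
  qed
next
  assume "m \<in> {1, 2, 3, 4, 5, 6, 7, 8, 10, 12}"
  then have "admissible m"
    using admissible_1 admissible_2 admissible_3 admissible_4 admissible_5 admissible_6
      admissible_7 admissible_8 admissible_10 admissible_12 by blast
  then show ?lhs unfolding admissible_def .
qed

end
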